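(* Let $\mathcal{H}_1,\mathcal{H}_2$ be separable Hilbert spaces and let $(\psi_k)_{k\in K}\subseteq\mathcal{H}_2$ and $(\phi_k)_{k\in K}\subseteq\mathcal{H}_1$ be Bessel sequences with Bessel bounds $B_1$ and $B_2$ respectively. For a symbol $m$ let $\mathbf{M}_{m,(\psi_k),(\phi_k)}f=\sum_k m_k\langle f,\phi_k\rangle\psi_k$. For each $l\in\mathbb{N}$ let $(\psi_k^{(l)})_{k\in K}\subseteq\mathcal{H}_2$ and $(\phi_k^{(l)})_{k\in K}\subseteq\mathcal{H}_1$ be sequences, and let $m$, $m^{(l)}$ ($l\in\mathbb{N}$) be scalar sequences indexed by $K$. All limits below are for $l\to\infty$. 1. (a) If $m^{(l)}\to m$ in $l^\infty$, then $\|\mathbf{M}_{m^{(l)},(\psi_k),(\phi_k)}-\mathbf{M}_{m,(\psi_k),(\phi_k)}\|_{Op}\to0$. (b) If $m^{(l)}\to m$ in $l^2$, then $\|\mathbf{M}_{m^{(l)},(\psi_k),(\phi_k)}-\mathbf{M}_{m,(\psi_k),(\phi_k)}\|_{\mathcal{HS}}\to0$. (c) If $m^{(l)}\to m$ in $l^1$, then $\|\mathbf{M}_{m^{(l)},(\psi_k),(\phi_k)}-\mathbf{M}_{m,(\psi_k),(\phi_k)}\|_{trace}\to0$. 2. (a) If $m\in l^1$ and the $(\psi_k^{(l)})$ are Bessel sequences converging uniformly to $(\psi_k)$, then $\|\mathbf{M}_{m,(\psi_k^{(l)}),(\phi_k)}-\mathbf{M}_{m,(\psi_k),(\phi_k)}\|_{trace}\to0$.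 (b) If $m\in l^2$ and $(\psi_k^{(l)})$ converges to $(\psi_k)$ in an $l^2$ sense, then $\|\mathbf{M}_{m,(\psi_k^{(l)}),(\phi_k)}-\mathbf{M}_{m,(\psi_k),(\phi_k)}\|_{\mathcal{HS}}\to0$. (c) If $m\in l^\infty$ and $(\psi_k^{(l)})$ converges to $(\psi_k)$ in an $l^1$ sense, then $\|\mathbf{M}_{m,(\psi_k^{(l)}),(\phi_k)}-\mathbf{M}_{m,(\psi_k),(\phi_k)}\|_{Op}\to0$. 3. Suppose the $(\phi_k^{(l)})$ are Bessel sequences. (a) If $m\in l^1$ and $(\phi_k^{(l)})$ converges uniformly to $(\phi_k)$, then $\|\mathbf{M}_{m,(\psi_k),(\phi_k^{(l)})}-\mathbf{M}_{m,(\psi_k),(\phi_k)}\|_{trace}\to0$. (b) If $m\in l^2$ and $(\phi_k^{(l)})$ converges to $(\phi_k)$ in an $l^2$ sense, then $\|\mathbf{M}_{m,(\psi_k),(\phi_k^{(l)})}-\mathbf{M}_{m,(\psi_k),(\phi_k)}\|_{\mathcal{HS}}\to0$. (c) If $m\in l^\infty$ and $(\phi_k^{(l)})$ converges to $(\phi_k)$ in an $l^1$ sense, then $\|\mathbf{M}_{m,(\psi_k),(\phi_k^{(l)})}-\mathbf{M}_{m,(\psi_k),(\phi_k)}\|_{Op}\to0$. 4. (a) If $m^{(l)}\to m$ in $l^1$, the $(\psi_k^{(l)})$ and $(\phi_k^{(l)})$ are Bessel sequences with bounds $B_1^{(l)}$ and $B_2^{(l)}$ such that there exist constants $\mathbf{B}_1,\mathbf{B}_2$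 with $B_1^{(l)}\le\mathbf{B}_1$ and $B_2^{(l)}\le\mathbf{B}_2$ for all $l$, and $(\psi_k^{(l)})$, $(\phi_k^{(l)})$ converge uniformly to $(\psi_k)$, $(\phi_k)$ respectively, then $\|\mathbf{M}_{m^{(l)},(\psi_k^{(l)}),(\phi_k^{(l)})}-\mathbf{M}_{m,(\psi_k),(\phi_k)}\|_{trace}\to0$. (b) If $m^{(l)}\to m$ in $l^2$ and $(\psi_k^{(l)})$, $(\phi_k^{(l)})$ converge to $(\psi_k)$, $(\phi_k)$ respectively in an $l^2$ sense, then $\|\mathbf{M}_{m^{(l)},(\psi_k^{(l)}),(\phi_k^{(l)})}-\mathbf{M}_{m,(\psi_k),(\phi_k)}\|_{\mathcal{HS}}\to0$. (c) If $m^{(l)}\to m$ in $l^\infty$ and $(\psi_k^{(l)})$, $(\phi_k^{(l)})$ converge to $(\psi_k)$, $(\phi_k)$ respectively in an $l^1$ sense, then $\|\mathbf{M}_{m^{(l)},(\psi_k^{(l)}),(\phi_k^{(l)})}-\mathbf{M}_{m,(\psi_k),(\phi_k)}\|_{Op}\to0$.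
   Context: $K$ is a countable index set; $l^p=l^p(K)$. Inner products are linear in the first argument. A sequence $(\psi_k)_{k\in K}$ in a Hilbert space $\mathcal{H}$ is a Bessel sequence with bound $B>0$ if $\sum_k|\langle f,\psi_k\rangle|^2\le B\|f\|^2$ for all $f\in\mathcal{H}$. For Bessel sequences $(\psi_k)$ in $\mathcal{H}_2$, $(\phi_k)$ in $\mathcal{H}_1$ and $m\in l^\infty(K)$, $\mathbf{M}_{m,(\psi_k),(\phi_k)}:\mathcal{H}_1\to\mathcal{H}_2$ is the Bessel multiplier $f\mapsto\sum_k m_k\langle f,\phi_k\rangle\psi_k$. "$m^{(l)}\to m$ in $l^p$" means $m,m^{(l)}\in l^p$ and $\|m^{(l)}-m\|_p\to0$. For $1\le p<\infty$, sequences $(\psi_k^{(l)})_{k\in K}$ converge to $(\psi_k)_{k\in K}$ in an $l^p$ sense if for every $\varepsilon>0$ there is $N>0$ with $\left(\sum_k\|\psi_k^{(l)}-\psi_k\|^p\right)^{1/p}<\varepsilon$ for all $l\ge N$; they converge uniformly if for every $\varepsilon>0$ there is $N>0$ with $\sup_k\|\psi_k^{(l)}-\psi_k\|<\varepsilon$ for all $l\ge N$. Where the sequences indexed by $l$ are not assumed to be Bessel (items 2(b), 2(c), 4(b), 4(c)), they are Bessel for all sufficiently large $l$, and the multipliers are considered for such $l$. $\|\cdot\|_{Op}$, $\|\cdot\|_{trace}$, $\|\cdot\|_{\mathcal{HS}}$ are the operator, trace class and Hilbert–Schmidt norms. *)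

theory Defs
  imports "HOL-Analysis.Analysis"
begin

section \<open>Complex Hilbert spaces\<close>

text \<open>The real structure inherited from \<^class>\<open>real_normed_vector\<close> is the restriction of the complex
  one. The last axiom says at once that the inner product is positive definite and that it
  induces the norm.\<close>

class complex_inner = real_normed_vector +
  fixes scaleC :: "complex \<Rightarrow> 'a \<Rightarrow> 'a" (infixr \<open>*\<^sub>C\<close> 75)
    and cinner :: "'a \<Rightarrow> 'a \<Rightarrow> complex"
  assumes scaleC_add_right: "c *\<^sub>C (x + y) = c *\<^sub>C x + c *\<^sub>C y"
    and scaleC_add_left: "(c + d) *\<^sub>C x = c *\<^sub>C x + d *\<^sub>C x"
    and scaleC_scaleC: "c *\<^sub>C d *\<^sub>C x = (c * d) *\<^sub>C x"
    and scaleC_one: "1 *\<^sub>C x = x"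
    and scaleR_scaleC: "r *\<^sub>R x = complex_of_real r *\<^sub>C x"
    and cinner_commute: "cinner x y = cnj (cinner y x)"
    and cinner_add_left: "cinner (x + y) z = cinner x z + cinner y z"
    and cinner_scaleC_left: "cinner (c *\<^sub>C x) y = c * cinner x y"
    and cinner_self: "cinner x x = complex_of_real ((norm x)\<^sup>2)"

class chilbert_space = complex_inner + complete_space
begin

subclass banach ..

end

instantiation complex :: chilbert_space
begin

definition scaleC_complex :: "complex \<Rightarrow> complex \<Rightarrow> complex" where
  "scaleC_complex c x = c * x"

definition cinner_complex :: "complex \<Rightarrow> complex \<Rightarrow> complex" where
  "cinner_complex x y = x * cnj y"

instance
  by standard
    (auto simp: scaleC_complex_def cinner_complex_def algebra_simps scaleR_conv_of_real
      complex_norm_square simp flip: of_real_power)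

end

definition bounded_clinear :: "('a::complex_inner \<Rightarrow> 'b::complex_inner) \<Rightarrow> bool" where
  "bounded_clinear T \<longleftrightarrow> bounded_linear T \<and> (\<forall>c x. T (c *\<^sub>C x) = c *\<^sub>C T x)"

definition is_onb :: "'a::complex_inner set \<Rightarrow> bool" where
  "is_onb E \<longleftrightarrow> (\<forall>e\<in>E. norm e = 1) \<and> (\<forall>e\<in>E. \<forall>e'\<in>E. e \<noteq> e' \<longrightarrow> cinner e e' = 0) \<and>
     closure (module.span scaleC E) = UNIV"

text \<open>A fixed orthonormal basis. The Hilbert--Schmidt and trace norms below do not depend on
  which one is taken.\<close>

definition some_onb :: "'a::complex_inner set" where
  "some_onb = (SOME E. is_onb E)"


section \<open>Hilbert--Schmidt and trace class operators\<close>

definition hilbert_schmidt :: "('a::complex_inner \<Rightarrow> 'b::complex_inner) \<Rightarrow> bool" where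
  "hilbert_schmidt T \<longleftrightarrow> bounded_clinear T \<and> (\<lambda>e. (norm (T e))\<^sup>2) summable_on some_onb"

definition hs_norm :: "('a::complex_inner \<Rightarrow> 'b::complex_inner) \<Rightarrow> real" where
  "hs_norm T = sqrt (\<Sum>\<^sub>\<infinity>e\<in>some_onb. (norm (T e))\<^sup>2)"

definition cadjoint :: "('a::complex_inner \<Rightarrow> 'b::complex_inner) \<Rightarrow> 'b \<Rightarrow> 'a" where
  "cadjoint T = (SOME S. \<forall>x y. cinner (T x) y = cinner x (S y))"

definition positive_op :: "('a::complex_inner \<Rightarrow> 'a) \<Rightarrow> bool" where
  "positive_op P \<longleftrightarrow> bounded_clinear P \<and> (\<forall>x. cinner (P x) x \<in> \<real> \<and> 0 \<le> Re (cinner (P x) x))"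

text \<open>The operator \<open>|T|\<close>, i.e. the (unique) positive square root of \<open>T\<^sup>* T\<close>.\<close>

definition abs_op :: "('a::complex_inner \<Rightarrow> 'b::complex_inner) \<Rightarrow> 'a \<Rightarrow> 'a" where
  "abs_op T = (SOME P. positive_op P \<and> P \<circ> P = cadjoint T \<circ> T)"

definition trace_class :: "('a::complex_inner \<Rightarrow> 'b::complex_inner) \<Rightarrow> bool" where
  "trace_class T \<longleftrightarrow> bounded_clinear T \<and>
     (\<lambda>e. Re (cinner (abs_op T e) e)) summable_on some_onb"

definition trace_norm :: "('a::complex_inner \<Rightarrow> 'b::complex_inner) \<Rightarrow> real" where
  "trace_norm T = (\<Sum>\<^sub>\<infinity>e\<in>some_onb. Re (cinner (abs_op T e) e))"

text \<open>\<open>onorm\<close>, \<open>hs_norm\<close> and \<open>trace_norm\<close> are real-valued and carry no information outside their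
  operator class, so convergence includes that the differences eventually lie in that class.\<close>

definition converges_op ::
    "(nat \<Rightarrow> 'a::complex_inner \<Rightarrow> 'b::complex_inner) \<Rightarrow> ('a \<Rightarrow> 'b) \<Rightarrow> bool" where
  "converges_op S T \<longleftrightarrow> (\<forall>\<^sub>F l in sequentially. bounded_clinear (\<lambda>f. S l f - T f)) \<and>
     (\<lambda>l. onorm (\<lambda>f. S l f - T f)) \<longlonglongrightarrow> 0"

definition converges_hs ::
    "(nat \<Rightarrow> 'a::complex_inner \<Rightarrow> 'b::complex_inner) \<Rightarrow> ('a \<Rightarrow> 'b) \<Rightarrow> bool" where
  "converges_hs S T \<longleftrightarrow> (\<forall>\<^sub>F l in sequentially. hilbert_schmidt (\<lambda>f. S l f - T f)) \<and>
     (\<lambda>l. hs_norm (\<lambda>f. S l f - T f)) \<longlonglongrightarrow> 0"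

definition converges_trace ::
    "(nat \<Rightarrow> 'a::complex_inner \<Rightarrow> 'b::complex_inner) \<Rightarrow> ('a \<Rightarrow> 'b) \<Rightarrow> bool" where
  "converges_trace S T \<longleftrightarrow> (\<forall>\<^sub>F l in sequentially. trace_class (\<lambda>f. S l f - T f)) \<and>
     (\<lambda>l. trace_norm (\<lambda>f. S l f - T f)) \<longlonglongrightarrow> 0"


section \<open>Families of type \<open>l\<^sup>p\<close>\<close>

text \<open>Here \<open>1 \<le> p < \<infinity>\<close>; families may be scalar or vector valued.\<close>

definition in_lp :: "real \<Rightarrow> 'k set \<Rightarrow> ('k \<Rightarrow> 'a::real_normed_vector) \<Rightarrow> bool" where
  "in_lp p K x \<longleftrightarrow> (\<lambda>k. norm (x k) powr p) summable_on K"

definition lp_norm :: "real \<Rightarrow> 'k set \<Rightarrow> ('k \<Rightarrow> 'a::real_normed_vector) \<Rightarrow> real" where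
  "lp_norm p K x = (\<Sum>\<^sub>\<infinity>k\<in>K. norm (x k) powr p) powr (1 / p)"

definition in_linf :: "'k set \<Rightarrow> ('k \<Rightarrow> 'a::real_normed_vector) \<Rightarrow> bool" where
  "in_linf K x \<longleftrightarrow> bounded (x ` K)"

text \<open>Inserting \<open>0\<close> only matters for \<open>K = {}\<close>, where the supremum in the reals is unspecified.\<close>

definition linf_norm :: "'k set \<Rightarrow> ('k \<Rightarrow> 'a::real_normed_vector) \<Rightarrow> real" where
  "linf_norm K x = Sup (insert 0 ((\<lambda>k. norm (x k)) ` K))"

definition symbols_converge_lp ::
    "real \<Rightarrow> 'k set \<Rightarrow> (nat \<Rightarrow> 'k \<Rightarrow> complex) \<Rightarrow> ('k \<Rightarrow> complex) \<Rightarrow> bool" where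
  "symbols_converge_lp p K m' m \<longleftrightarrow> in_lp p K m \<and> (\<forall>l. in_lp p K (m' l)) \<and>
     (\<lambda>l. lp_norm p K (\<lambda>k. m' l k - m k)) \<longlonglongrightarrow> 0"

definition symbols_converge_linf ::
    "'k set \<Rightarrow> (nat \<Rightarrow> 'k \<Rightarrow> complex) \<Rightarrow> ('k \<Rightarrow> complex) \<Rightarrow> bool" where
  "symbols_converge_linf K m' m \<longleftrightarrow> in_linf K m \<and> (\<forall>l. in_linf K (m' l)) \<and>
     (\<lambda>l. linf_norm K (\<lambda>k. m' l k - m k)) \<longlonglongrightarrow> 0"

definition seqs_converge_lp ::
    "real \<Rightarrow> 'k set \<Rightarrow> (nat \<Rightarrow> 'k \<Rightarrow> 'a::real_normed_vector) \<Rightarrow> ('k \<Rightarrow> 'a) \<Rightarrow> bool" where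
  "seqs_converge_lp p K x' x \<longleftrightarrow> (\<forall>\<epsilon>>0. \<exists>N>0. \<forall>l\<ge>N.
     in_lp p K (\<lambda>k. x' l k - x k) \<and> lp_norm p K (\<lambda>k. x' l k - x k) < \<epsilon>)"

definition seqs_converge_uniformly ::
    "'k set \<Rightarrow> (nat \<Rightarrow> 'k \<Rightarrow> 'a::real_normed_vector) \<Rightarrow> ('k \<Rightarrow> 'a) \<Rightarrow> bool" where
  "seqs_converge_uniformly K x' x \<longleftrightarrow> (\<forall>\<epsilon>>0. \<exists>N>0. \<forall>l\<ge>N.
     in_linf K (\<lambda>k. x' l k - x k) \<and> linf_norm K (\<lambda>k. x' l k - x k) < \<epsilon>)"


section \<open>Bessel sequences and multipliers\<close>

definition bessel_bound :: "'k set \<Rightarrow> ('k \<Rightarrow> 'a::complex_inner) \<Rightarrow> real \<Rightarrow> bool" where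
  "bessel_bound K \<psi> B \<longleftrightarrow> 0 < B \<and>
     (\<forall>f. (\<lambda>k. (cmod (cinner f (\<psi> k)))\<^sup>2) summable_on K \<and>
          (\<Sum>\<^sub>\<infinity>k\<in>K. (cmod (cinner f (\<psi> k)))\<^sup>2) \<le> B * (norm f)\<^sup>2)"

definition bessel :: "'k set \<Rightarrow> ('k \<Rightarrow> 'a::complex_inner) \<Rightarrow> bool" where
  "bessel K \<psi> \<longleftrightarrow> (\<exists>B. bessel_bound K \<psi> B)"

text \<open>The sum is the unconditional sum in the norm of the target space; it exists for Bessel
  sequences and bounded symbols.\<close>

definition multiplier :: "'k set \<Rightarrow> ('k \<Rightarrow> complex) \<Rightarrow> ('k \<Rightarrow> 'b::complex_inner) \<Rightarrow>
    ('k \<Rightarrow> 'a::complex_inner) \<Rightarrow> 'a \<Rightarrow> 'b" where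
  "multiplier K m \<psi> \<phi> f = (\<Sum>\<^sub>\<infinity>k\<in>K. (m k * cinner f (\<phi> k)) *\<^sub>C \<psi> k)"

end

theory Submission
  imports Defs
begin

text \<open>The difference of two multipliers telescopes into three multipliers, each with one small
  entry, so everything reduces to bounding each of the three norms of a multiplier by the product
  of the \<open>l\<^sup>p\<close> norm of the symbol and the sizes of the two sequences (square roots of Bessel
  bounds, or suprema for the trace norm). A sequence that is small in \<open>l\<^sup>1\<close> or \<open>l\<^sup>2\<close> is a Bessel
  sequence with a small bound, and parts 1 to 3 are part 4 for constant sequences.
  For the trace norm, \<open>\<langle>|T|e, e\<rangle> = \<langle>Te, u\<^sub>e\<rangle>\<close> with \<open>u\<^sub>e\<close> the image of \<open>e\<close> under the polar
  partial isometry of \<open>T\<close>, and Cauchy--Schwarz together with Bessel's inequality bounds the sum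
  over \<open>e\<close> for each rank one summand.\<close>

section \<open>Complex inner product spaces\<close>

text \<open>Adjoint, modulus and orthonormal basis enter the definitions as \<open>SOME\<close>
  choices, so the trace norm says nothing until witnesses exist: Riesz representation gives the
  adjoint, a fixed point iteration the square root of \<open>cadjoint T \<circ> T\<close>, and
  Zorn's lemma the basis. A second obstacle is that the modulus of a sum has no simple relation to
  the moduli of the summands, while a multiplier is known only as an unconditional limit of finite
  sums. Each norm is therefore replaced by an inequality on single vectors or on finite subsets of
  the basis. Such inequalities add up and survive pointwise limits; they are turned into membership
  in the operator class and a bound on its norm only at the very end. Square roots of Bessel bounds
  are the right sizes because they are norms of analysis operators and so obey the triangle
  inequality.\<close>

lemma cinner_add_right: "cinner x (y + z) = cinner x y + cinner x z"
  by (metis cinner_add_left cinner_commute complex_cnj_add)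

lemma cinner_scaleC_right: "cinner x (c *\<^sub>C y) = cnj c * cinner x y"
  by (metis cinner_commute cinner_scaleC_left complex_cnj_mult)

lemma cinner_zero_left [simp]: "cinner 0 x = 0"
  using cinner_add_left[of 0 0 x] by simp

lemma cinner_zero_right [simp]: "cinner x 0 = 0"
  using cinner_add_right[of x 0 0] by simp

lemma cinner_minus_left: "cinner (- x) y = - cinner x y"
  using cinner_add_left[of "- x" x y] by (simp add: eq_neg_iff_add_eq_0)

lemma cinner_minus_right: "cinner x (- y) = - cinner x y"
  using cinner_add_right[of x "- y" y] by (simp add: eq_neg_iff_add_eq_0)

lemma cinner_diff_left: "cinner (x - y) z = cinner x z - cinner y z"
  using cinner_add_left[of x "- y" z] by (simp add: cinner_minus_left)

lemma cinner_diff_right: "cinner x (y - z) = cinner x y - cinner x z"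
  using cinner_add_right[of x y "- z"] by (simp add: cinner_minus_right)

lemma cinner_sum_left: "cinner (\<Sum>i\<in>A. f i) y = (\<Sum>i\<in>A. cinner (f i) y)"
  by (induction A rule: infinite_finite_induct) (auto simp: cinner_add_left)

lemma cinner_sum_right: "cinner y (\<Sum>i\<in>A. f i) = (\<Sum>i\<in>A. cinner y (f i))"
  by (induction A rule: infinite_finite_induct) (auto simp: cinner_add_right)

lemma scaleC_zero_right [simp]: "c *\<^sub>C (0::'a::complex_inner) = 0"
  using scaleC_add_right[of c 0 "0::'a"] by simp

lemma scaleC_zero_left [simp]: "0 *\<^sub>C (x::'a::complex_inner) = 0"
  using scaleC_add_left[of 0 0 x] by simp

lemma scaleC_minus_right: "c *\<^sub>C (- x) = - (c *\<^sub>C (x::'a::complex_inner))"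
  using scaleC_add_right[of c "- x" x] by (simp add: eq_neg_iff_add_eq_0)

lemma scaleC_diff_right: "c *\<^sub>C (x - y) = c *\<^sub>C x - c *\<^sub>C (y::'a::complex_inner)"
  using scaleC_add_right[of c x "- y"] by (simp add: scaleC_minus_right)

lemma scaleC_minus_left: "(- c) *\<^sub>C x = - (c *\<^sub>C (x::'a::complex_inner))"
  using scaleC_add_left[of "- c" c x] by (simp add: eq_neg_iff_add_eq_0)

lemma scaleC_diff_left: "(c - d) *\<^sub>C x = c *\<^sub>C x - d *\<^sub>C (x::'a::complex_inner)"
  using scaleC_add_left[of c "- d" x] by (simp add: scaleC_minus_left)

lemma norm_sq_cinner: "(norm x)\<^sup>2 = Re (cinner x x)"
  by (simp add: cinner_self)

lemma Im_cinner_self: "Im (cinner x x) = 0"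
  by (simp add: cinner_self)

lemma cinner_eq_zeroD: "cinner x x = 0 \<Longrightarrow> x = 0"
  by (simp add: cinner_self)

lemma cinner_ext_right: "(\<And>x. cinner x y = cinner x z) \<Longrightarrow> y = z"
  by (metis cinner_diff_right cinner_eq_zeroD eq_iff_diff_eq_0)

lemma norm_scaleC: "norm (c *\<^sub>C x) = cmod c * norm (x::'a::complex_inner)"
proof -
  have "cinner (c *\<^sub>C x) (c *\<^sub>C x) = (c * cnj c) * cinner x x"
    by (simp add: cinner_scaleC_left cinner_scaleC_right)
  also have "\<dots> = complex_of_real ((cmod c)\<^sup>2) * complex_of_real ((norm x)\<^sup>2)"
    by (simp only: complex_norm_square cinner_self)
  finally have "(norm (c *\<^sub>C x))\<^sup>2 = (cmod c * norm x)\<^sup>2"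
    by (simp add: norm_sq_cinner[of "c *\<^sub>C x"] power_mult_distrib flip: of_real_mult of_real_power)
  then show ?thesis
    by (simp add: power2_eq_iff_nonneg)
qed

lemma norm_add_sq: "(norm (x + y))\<^sup>2 = (norm x)\<^sup>2 + 2 * Re (cinner x y) + (norm y)\<^sup>2"
proof -
  have "Re (cinner y x) = Re (cinner x y)"
    by (subst cinner_commute) simp
  then show ?thesis
    by (simp add: norm_sq_cinner cinner_add_left cinner_add_right)
qed

lemma norm_diff_sq: "(norm (x - y))\<^sup>2 = (norm x)\<^sup>2 - 2 * Re (cinner x y) + (norm y)\<^sup>2"
  using norm_add_sq[of x "- y"] by (simp add: cinner_minus_right)

lemma parallelogram: "(norm (x + y))\<^sup>2 + (norm (x - y))\<^sup>2 = 2 * (norm x)\<^sup>2 + 2 * (norm (y::'a::complex_inner))\<^sup>2"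
  by (simp add: norm_add_sq norm_diff_sq)

lemma norm_cinner_le: "cmod (cinner x y) \<le> norm x * norm y"
proof (cases "y = 0")
  case False
  \<comment> \<open>\<open>c\<close> is the coefficient of the orthogonal projection of
    \<open>x\<close> onto the line through \<open>y\<close>. Expanding the squared length of the
    residual gives the squared claim divided by \<open>(norm y)\<^sup>2\<close>.\<close>
  define c where "c = cinner x y / complex_of_real ((norm y)\<^sup>2)"
  have n: "norm y > 0" using False by simp
  have c: "cnj c * cinner x y = complex_of_real ((cmod (cinner x y))\<^sup>2 / (norm y)\<^sup>2)"
    unfolding c_def of_real_divide complex_norm_square[of "cinner x y"]
    by (simp add: mult_ac)
  have "0 \<le> (norm (x - c *\<^sub>C y))\<^sup>2" by simp
  also have "\<dots> = (norm x)\<^sup>2 - 2 * Re (cnj c * cinner x y) + (cmod c * norm y)\<^sup>2"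
    by (simp add: norm_diff_sq cinner_scaleC_right norm_scaleC)
  also have "Re (cnj c * cinner x y) = (cmod (cinner x y))\<^sup>2 / (norm y)\<^sup>2"
    unfolding c by simp
  also have "(cmod c * norm y)\<^sup>2 = (cmod (cinner x y))\<^sup>2 / (norm y)\<^sup>2"
    using n by (simp add: c_def norm_divide power_mult_distrib power_divide norm_power norm_mult field_simps
        power2_eq_square)
  finally have "(cmod (cinner x y))\<^sup>2 / (norm y)\<^sup>2 \<le> (norm x)\<^sup>2" by simp
  then have "(cmod (cinner x y))\<^sup>2 \<le> (norm x * norm y)\<^sup>2"
    using n by (simp add: field_simps power_mult_distrib)
  then show ?thesis
    by (simp add: power2_le_iff_abs_le)
qed simp

lemma cinner_scaleR_left: "cinner (r *\<^sub>R x) y = r *\<^sub>R cinner x y"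
  by (simp add: scaleR_scaleC[of r x] cinner_scaleC_left scaleR_conv_of_real)

lemma cinner_scaleR_right: "cinner x (r *\<^sub>R y) = r *\<^sub>R cinner x y"
  by (simp add: scaleR_scaleC[of r y] cinner_scaleC_right scaleR_conv_of_real)

lemma bounded_linear_cinner_left: "bounded_linear (\<lambda>x. cinner x y)"
  by (rule bounded_linear_intro[where K = "norm y"])
     (auto simp: cinner_add_left cinner_scaleR_left norm_cinner_le)

lemma bounded_linear_cinner_right: "bounded_linear (\<lambda>y. cinner x y)"
  by (rule bounded_linear_intro[where K = "norm x"])
     (simp_all add: cinner_add_right cinner_scaleR_right, metis mult.commute norm_cinner_le)

lemma bounded_linear_scaleC_right: "bounded_linear (\<lambda>x::'a::complex_inner. c *\<^sub>C x)"
  by (rule bounded_linear_intro[where K = "cmod c"])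
     (auto simp: scaleC_add_right scaleR_scaleC scaleC_scaleC norm_scaleC mult_ac)

lemmas tendsto_cinner_left = bounded_linear.tendsto[OF bounded_linear_cinner_left]
lemmas tendsto_cinner_right = bounded_linear.tendsto[OF bounded_linear_cinner_right]
lemmas tendsto_scaleC_right = bounded_linear.tendsto[OF bounded_linear_scaleC_right]

lemma bounded_clinearD:
  assumes "bounded_clinear T"
  shows "bounded_linear T" "T (x + y) = T x + T y" "T (x - y) = T x - T y" "T 0 = 0"
    "T (c *\<^sub>C x) = c *\<^sub>C T x" "T (\<Sum>i\<in>A. g i) = (\<Sum>i\<in>A. T (g i))"
  using assms by (auto simp: bounded_clinear_def linear_simps linear_sum bounded_linear.linear)

lemma bounded_clinear_intro:
  assumes "\<And>x y. T (x + y) = T x + T y" "\<And>c x. T (c *\<^sub>C x) = c *\<^sub>C T x"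
    and "\<And>x. norm (T x) \<le> M * norm x"
  shows "bounded_clinear T"
  unfolding bounded_clinear_def
  using assms by (auto intro!: bounded_linear_intro[where K = M] simp: scaleR_scaleC mult.commute)

lemma bounded_clinear_bound:
  assumes "bounded_clinear T"
  obtains M where "M > 0" "\<And>x. norm (T x) \<le> M * norm x"
  using bounded_linear.pos_bounded[OF bounded_clinearD(1)[OF assms]] by (auto simp: mult.commute)

section \<open>Orthogonal projections, the Riesz representation and adjoints\<close>

definition csubspace :: "'a::complex_inner set \<Rightarrow> bool" where
  "csubspace S \<longleftrightarrow> 0 \<in> S \<and> (\<forall>x\<in>S. \<forall>y\<in>S. x + y \<in> S) \<and> (\<forall>c. \<forall>x\<in>S. c *\<^sub>C x \<in> S)"

lemma csubspace_sum:
  "csubspace S \<Longrightarrow> (\<And>i. i \<in> A \<Longrightarrow> f i \<in> S) \<Longrightarrow> (\<Sum>i\<in>A. f i) \<in> S"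
  by (induction A rule: infinite_finite_induct) (auto simp: csubspace_def)

lemma csubspace_closure:
  assumes S: "csubspace (S :: 'a::complex_inner set)"
  shows "csubspace (closure S)"
  unfolding csubspace_def
proof (intro conjI ballI allI)
  show "0 \<in> closure S"
    using S closure_subset by (auto simp: csubspace_def)
next
  fix x y assume "x \<in> closure S" "y \<in> closure S"
  then obtain f g where fg: "\<And>n. f n \<in> S" "f \<longlonglongrightarrow> x" "\<And>n. g n \<in> S" "g \<longlonglongrightarrow> y"
    unfolding closure_sequential by blast
  then have "(\<lambda>n. f n + g n) \<longlonglongrightarrow> x + y" "\<forall>n. f n + g n \<in> S"
    using S by (auto intro: tendsto_add simp: csubspace_def)
  then show "x + y \<in> closure S"
    unfolding closure_sequential by (intro exI[of _ "\<lambda>n. f n + g n"]) blast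
next
  fix c x assume "x \<in> closure S"
  then obtain f where fg: "\<And>n. f n \<in> S" "f \<longlonglongrightarrow> x"
    unfolding closure_sequential by blast
  then have "(\<lambda>n. c *\<^sub>C f n) \<longlonglongrightarrow> c *\<^sub>C x" "\<forall>n. c *\<^sub>C f n \<in> S"
    using S by (auto intro: tendsto_scaleC_right simp: csubspace_def)
  then show "c *\<^sub>C x \<in> closure S"
    unfolding closure_sequential by (intro exI[of _ "\<lambda>n. c *\<^sub>C f n"]) blast
qed

text \<open>If the inner product were nonzero, moving \<open>p\<close> along \<open>y\<close> by the
  projection coefficient \<open>c\<close> would lower the squared distance to \<open>x\<close> by
  \<open>(cmod (cinner (x - p) y))\<^sup>2 / (norm y)\<^sup>2\<close>, against minimality.\<close>

lemma closest_imp_orthogonal: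
  fixes p x :: "'a::complex_inner"
  assumes S: "csubspace S" and p: "p \<in> S" and min: "\<And>y. y \<in> S \<Longrightarrow> norm (x - p) \<le> norm (x - y)"
    and y: "y \<in> S"
  shows "cinner (x - p) y = 0"
proof (cases "y = 0")
  case False
  define c where "c = cinner (x - p) y / complex_of_real ((norm y)\<^sup>2)"
  have n: "norm y > 0" using False by simp
  have "p + c *\<^sub>C y \<in> S" using S p y by (simp add: csubspace_def)
  then have "norm (x - p) \<le> norm (x - p - c *\<^sub>C y)"
    using min[of "p + c *\<^sub>C y"] by (simp add: algebra_simps)
  then have "(norm (x - p))\<^sup>2 \<le> (norm (x - p - c *\<^sub>C y))\<^sup>2"
    by (simp add: power_mono)
  also have "\<dots> = (norm (x - p))\<^sup>2 - 2 * Re (cnj c * cinner (x - p) y) + (cmod c * norm y)\<^sup>2"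
    by (subst norm_diff_sq) (simp add: cinner_scaleC_right norm_scaleC)
  also have "cnj c * cinner (x - p) y = complex_of_real ((cmod (cinner (x - p) y))\<^sup>2 / (norm y)\<^sup>2)"
    unfolding c_def of_real_divide complex_norm_square[of "cinner (x - p) y"]
    by (simp add: mult_ac)
  also have "Re \<dots> = (cmod (cinner (x - p) y))\<^sup>2 / (norm y)\<^sup>2" by simp
  also have "(cmod c * norm y)\<^sup>2 = (cmod (cinner (x - p) y))\<^sup>2 / (norm y)\<^sup>2"
    using n by (simp add: c_def norm_divide power_mult_distrib power_divide norm_power norm_mult field_simps
        power2_eq_square)
  finally have "(cmod (cinner (x - p) y))\<^sup>2 / (norm y)\<^sup>2 \<le> 0" by simp
  then have "(cmod (cinner (x - p) y))\<^sup>2 \<le> 0"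
    using n by (simp add: divide_le_0_iff)
  then show ?thesis by simp
qed simp

text \<open>A distance minimising sequence in \<open>S\<close> is Cauchy by the parallelogram law,
  and its limit is a closest point, to which \<open>closest_imp_orthogonal\<close> applies.\<close>

lemma orthogonal_projection:
  fixes x :: "'a::chilbert_space"
  assumes S: "csubspace S" and cl: "closed S"
  obtains p where "p \<in> S" "\<And>y. y \<in> S \<Longrightarrow> cinner (x - p) y = 0"
proof -
  define d where "d = Inf ((\<lambda>y. norm (x - y)) ` S)"
  have ne: "S \<noteq> {}" using S by (auto simp: csubspace_def)
  have bdd: "bdd_below ((\<lambda>y. norm (x - y)) ` S)"
    by (rule bdd_belowI[where m = 0]) auto
  have d_le: "d \<le> norm (x - y)" if "y \<in> S" for y
    unfolding d_def using that bdd by (auto intro: cInf_lower)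
  have d0: "0 \<le> d"
    unfolding d_def using ne by (intro cInf_greatest) auto
  have "\<exists>y\<in>S. norm (x - y) < d + 1 / real (Suc n)" for n
  proof -
    have "d < d + 1 / real (Suc n)" by simp
    then show ?thesis
      unfolding d_def using cInf_lessD[of "(\<lambda>y. norm (x - y)) ` S"] ne by auto
  qed
  then obtain f where f: "\<And>n. f n \<in> S" "\<And>n. norm (x - f n) < d + 1 / real (Suc n)"
    by metis
  \<comment> \<open>The midpoint \<open>q\<close> of \<open>f m\<close> and \<open>f n\<close> lies
    in \<open>S\<close>, so its distance from \<open>x\<close> is at least \<open>d\<close>. This
    bounds the first term of the parallelogram law from below.\<close>
  have key: "(norm (f m - f n))\<^sup>2 \<le> 2 * (norm (x - f m))\<^sup>2 + 2 * (norm (x - f n))\<^sup>2 - 4 * d\<^sup>2" for m n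
  proof -
    define q where "q = (1/2::complex) *\<^sub>C (f m + f n)"
    have qS: "q \<in> S" using S f(1) by (simp add: q_def csubspace_def)
    have two: "2 *\<^sub>C z = z + z" for z :: 'a
      using scaleC_add_left[of 1 1 z] by (simp add: scaleC_one)
    have "2 *\<^sub>C q = f m + f n"
      by (simp add: q_def scaleC_scaleC scaleC_one)
    then have "(x - f m) + (x - f n) = 2 *\<^sub>C (x - q)"
      by (simp add: scaleC_diff_right two algebra_simps)
    then have "norm ((x - f m) + (x - f n)) = 2 * norm (x - q)"
      by (simp add: norm_scaleC)
    moreover have "d\<^sup>2 \<le> (norm (x - q))\<^sup>2"
      using d_le[OF qS] d0 by (simp add: power_mono)
    ultimately have "4 * d\<^sup>2 \<le> (norm ((x - f m) + (x - f n)))\<^sup>2"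
      by (simp add: power_mult_distrib)
    moreover have "norm ((x - f m) - (x - f n)) = norm (f m - f n)"
      by (simp add: norm_minus_commute)
    ultimately show ?thesis
      using parallelogram[of "x - f m" "x - f n"] by simp
  qed
  have lim: "(\<lambda>n. norm (x - f n)) \<longlonglongrightarrow> d"
  proof (rule tendsto_sandwich[of "\<lambda>_. d" _ _ "\<lambda>n. d + 1 / real (Suc n)"])
    show "(\<lambda>n. d + 1 / real (Suc n)) \<longlonglongrightarrow> d"
      using tendsto_add[OF tendsto_const[of d] LIMSEQ_inverse_real_of_nat] by (simp add: field_simps)
  qed (use f d_le in \<open>auto intro!: always_eventually less_imp_le\<close>)
  have lim2: "(\<lambda>n. (norm (x - f n))\<^sup>2) \<longlonglongrightarrow> d\<^sup>2"
    using tendsto_power[OF lim] .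
  have "Cauchy f"
  proof (rule metric_CauchyI)
    fix e :: real assume e: "0 < e"
    \<comment> \<open>The margin \<open>e\<^sup>2 / 4\<close> enters \<open>key\<close> twice with
      factor 2, which gives exactly \<open>e\<^sup>2\<close>.\<close>
    then have "\<forall>\<^sub>F n in sequentially. (norm (x - f n))\<^sup>2 < d\<^sup>2 + e\<^sup>2 / 4"
      using lim2 by (intro order_tendstoD(2)) auto
    then obtain N where N: "\<And>n. n \<ge> N \<Longrightarrow> (norm (x - f n))\<^sup>2 < d\<^sup>2 + e\<^sup>2 / 4"
      unfolding eventually_sequentially by blast
    have "dist (f m) (f n) < e" if "m \<ge> N" "n \<ge> N" for m n
    proof -
      have "(norm (f m - f n))\<^sup>2 < e\<^sup>2"
        using key[of m n] N[OF that(1)] N[OF that(2)] by simp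
      then show ?thesis
        using e by (simp add: dist_norm power2_less_imp_less)
    qed
    then show "\<exists>M. \<forall>m\<ge>M. \<forall>n\<ge>M. dist (f m) (f n) < e" by blast
  qed
  then obtain p where p: "f \<longlonglongrightarrow> p"
    using Cauchy_convergent convergent_def by blast
  have pS: "p \<in> S"
    using closed_sequentially[OF cl] f(1) p by blast
  have "(\<lambda>n. norm (x - f n)) \<longlonglongrightarrow> norm (x - p)"
    by (intro tendsto_intros p)
  then have "norm (x - p) = d"
    using lim LIMSEQ_unique by blast
  then have "cinner (x - p) y = 0" if "y \<in> S" for y
    using closest_imp_orthogonal[OF S pS _ that] d_le by auto
  then show thesis
    using that pS by blast
qed

text \<open>For nonzero \<open>g\<close> the orthogonal complement of the kernel is a line, and a
  suitable multiple of any nonzero vector on it represents \<open>g\<close>.\<close>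

lemma riesz_representation:
  fixes g :: "'a::chilbert_space \<Rightarrow> complex"
  assumes g: "bounded_clinear g"
  obtains z where "\<And>x. g x = cinner x z"
proof (cases "\<forall>x. g x = 0")
  case True
  then show thesis using that[of 0] by simp
next
  case False
  then obtain w where w: "g w \<noteq> 0" by blast
  define S where "S = {x. g x = 0}"
  have S: "csubspace S"
    by (auto simp: S_def csubspace_def bounded_clinearD[OF g])
  have "closed S"
    unfolding S_def
    by (rule closed_Collect_eq) (auto intro: linear_continuous_on bounded_clinearD[OF g])
  then obtain p where p: "p \<in> S" "\<And>y. y \<in> S \<Longrightarrow> cinner (w - p) y = 0"
    using orthogonal_projection[OF S] by blast
  define v where "v = w - p"
  have gv: "g v \<noteq> 0" using p w by (simp add: v_def S_def bounded_clinearD[OF g])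
  have v0: "v \<noteq> 0" using gv bounded_clinearD(4)[OF g] by auto
  have eq: "g v * cinner x v = g x * cinner v v" for x
  proof -
    \<comment> \<open>This combination is chosen so that \<open>g\<close> kills it; its
      orthogonality to \<open>v\<close> then expresses \<open>g x\<close> through
      \<open>cinner x v\<close>.\<close>
    have "g v *\<^sub>C x - g x *\<^sub>C v \<in> S"
      by (simp add: S_def bounded_clinearD[OF g] scaleC_complex_def)
    then have "cinner v (g v *\<^sub>C x - g x *\<^sub>C v) = 0"
      using p(2) v_def by blast
    then have "cinner (g v *\<^sub>C x - g x *\<^sub>C v) v = 0"
      by (subst cinner_commute) simp
    then show ?thesis by (simp add: cinner_diff_left cinner_scaleC_left)
  qed
  have "g x = cinner x (cnj (g v / cinner v v) *\<^sub>C v)" for x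
    using eq[of x] v0 cinner_eq_zeroD[of v] by (auto simp: cinner_scaleC_right field_simps)
  then show thesis using that by blast
qed

text \<open>The Riesz vector of the functional \<open>\<lambda>x. cinner (T x) y\<close> is the
  witness behind the \<open>SOME\<close> choice.\<close>

lemma cadjoint:
  fixes T :: "'a::chilbert_space \<Rightarrow> 'b::complex_inner"
  assumes T: "bounded_clinear T"
  shows "cinner (T x) y = cinner x (cadjoint T y)"
proof -
  obtain M where M: "\<And>x. norm (T x) \<le> M * norm x"
    using bounded_clinear_bound[OF T] by blast
  have "\<exists>z. \<forall>x. cinner (T x) y = cinner x z" for y
  proof -
    have "norm (cinner (T x) y) \<le> (M * norm y) * norm x" for x
      using norm_cinner_le[of "T x" y] mult_right_mono[OF M[of x] norm_ge_zero[of y]]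
      by (simp add: mult_ac)
    then have "bounded_clinear (\<lambda>x. cinner (T x) y)"
      by (intro bounded_clinear_intro[where M = "M * norm y"])
         (auto simp: bounded_clinearD[OF T] cinner_add_left cinner_scaleC_left scaleC_complex_def)
    then show ?thesis
      using riesz_representation by metis
  qed
  then have "\<exists>S. \<forall>x y. cinner (T x) y = cinner x (S y)" by metis
  then have "\<forall>x y. cinner (T x) y = cinner x (cadjoint T y)"
    unfolding cadjoint_def by (rule someI_ex)
  then show ?thesis by blast
qed

lemma cadjoint':
  fixes T :: "'a::chilbert_space \<Rightarrow> 'b::complex_inner"
  assumes T: "bounded_clinear T"
  shows "cinner (cadjoint T y) x = cinner y (T x)"
  by (metis T cadjoint cinner_commute)

text \<open>Pair \<open>cadjoint T y\<close> with itself, move \<open>T\<close> to the other side,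
  and cancel one factor \<open>norm (cadjoint T y)\<close>.\<close>

lemma norm_cadjoint_le:
  fixes T :: "'a::chilbert_space \<Rightarrow> 'b::complex_inner"
  assumes T: "bounded_clinear T" and M: "\<And>x. norm (T x) \<le> M * norm x" and "0 \<le> M"
  shows "norm (cadjoint T y) \<le> M * norm y"
proof (cases "cadjoint T y = 0")
  case False
  let ?z = "cadjoint T y"
  have "(norm ?z)\<^sup>2 = Re (cinner y (T ?z))"
    by (simp add: norm_sq_cinner cadjoint'[OF T])
  also have "\<dots> \<le> norm y * norm (T ?z)"
    by (rule order_trans[OF complex_Re_le_cmod norm_cinner_le])
  also have "\<dots> \<le> norm y * (M * norm ?z)"
    by (intro mult_left_mono M) simp
  finally have "norm ?z * norm ?z \<le> (M * norm y) * norm ?z"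
    by (simp add: power2_eq_square mult_ac)
  then show ?thesis
    using False by simp
qed (use assms in simp)

lemma bounded_clinear_cadjoint:
  fixes T :: "'a::chilbert_space \<Rightarrow> 'b::complex_inner"
  assumes T: "bounded_clinear T"
  shows "bounded_clinear (cadjoint T)"
proof -
  obtain M where M: "M > 0" "\<And>x. norm (T x) \<le> M * norm x"
    using bounded_clinear_bound[OF T] by blast
  show ?thesis
  proof (rule bounded_clinear_intro[where M = M])
    show "norm (cadjoint T x) \<le> M * norm x" for x
      using norm_cadjoint_le[OF T M(2)] M(1) by simp
  qed (rule cinner_ext_right,
      simp add: cadjoint[OF T, symmetric] cinner_add_right cinner_scaleC_right)+
qed

section \<open>Orthonormal bases\<close>

text \<open>The span in \<open>is_onb\<close> is the raw locale constant, so its facts become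
  available only after the class axioms are interpreted as a \<open>module\<close>.\<close>

lemma csubspace_span: "csubspace (module.span scaleC (E :: 'a::complex_inner set))"
proof -
  interpret module "scaleC :: complex \<Rightarrow> 'a \<Rightarrow> 'a"
    by standard (auto simp: scaleC_add_right scaleC_add_left scaleC_scaleC scaleC_one)
  show ?thesis
    by (auto simp: csubspace_def span_zero span_add span_scale)
qed

lemma subset_span: "E \<subseteq> module.span scaleC (E :: 'a::complex_inner set)"
proof -
  interpret module "scaleC :: complex \<Rightarrow> 'a \<Rightarrow> 'a"
    by standard (auto simp: scaleC_add_right scaleC_add_left scaleC_scaleC scaleC_one)
  show ?thesis
    by (rule span_superset)
qed

definition orthonormal :: "'a::complex_inner set \<Rightarrow> bool" where
  "orthonormal E \<longleftrightarrow> (\<forall>e\<in>E. norm e = 1) \<and> (\<forall>e\<in>E. \<forall>e'\<in>E. e \<noteq> e' \<longrightarrow> cinner e e' = 0)"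

text \<open>A maximal orthonormal set exists by Zorn's lemma. A vector outside its closed span would
  leave a nonzero residual after projection, and the normalised residual could be adjoined to the
  set.\<close>

lemma is_onb_exists: "\<exists>E. is_onb (E :: 'a::chilbert_space set)"
proof -
  have "\<Union>C \<in> Collect orthonormal" if "subset.chain (Collect (orthonormal :: 'a set \<Rightarrow> bool)) C" for C
  proof -
    have C: "orthonormal X" if "X \<in> C" for X
      using \<open>subset.chain _ C\<close> that by (auto simp: subset_chain_def)
    have tot: "X \<subseteq> Y \<or> Y \<subseteq> X" if "X \<in> C" "Y \<in> C" for X Y
      using \<open>subset.chain _ C\<close> that by (auto simp: subset_chain_def)
    have "cinner e e' = 0" if "X \<in> C" "Y \<in> C" "e \<in> X" "e' \<in> Y" "e \<noteq> e'" for X Y e e'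
      using tot[OF that(1,2)] C[OF that(1)] C[OF that(2)] that(3-5)
      unfolding orthonormal_def by blast
    then show ?thesis
      using C by (auto simp: orthonormal_def)
  qed
  then obtain E :: "'a set" where E: "orthonormal E"
    and max: "\<And>X. orthonormal X \<Longrightarrow> E \<subseteq> X \<Longrightarrow> X = E"
    using subset_Zorn'[of "Collect (orthonormal :: 'a set \<Rightarrow> bool)"] by auto
  let ?S = "closure (module.span scaleC E)"
  have "x \<in> ?S" for x
  proof (rule ccontr)
    assume x: "x \<notin> ?S"
    obtain p where p: "p \<in> ?S" "\<And>y. y \<in> ?S \<Longrightarrow> cinner (x - p) y = 0"
      using orthogonal_projection[OF csubspace_closure[OF csubspace_span] closed_closure] by blast
    define v where "v = (1 / complex_of_real (norm (x - p))) *\<^sub>C (x - p)"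
    have n: "norm (x - p) > 0" using x p(1) by auto
    then have v: "norm v = 1" by (simp add: v_def norm_scaleC norm_divide)
    have orth: "cinner v e = 0" if "e \<in> E" for e
    proof -
      have "e \<in> ?S" using that subset_span closure_subset by blast
      then show ?thesis using p(2) by (simp add: v_def cinner_scaleC_left)
    qed
    then have orth': "cinner e v = 0" if "e \<in> E" for e
      using that by (subst cinner_commute) simp
    have "orthonormal (insert v E)"
      using E v orth orth' by (auto simp: orthonormal_def)
    then have "v \<in> E" using max by blast
    then have "cinner v v = 0" using orth by blast
    then show False using v by (simp add: cinner_self)
  qed
  then have "?S = UNIV" by blast
  then have "is_onb E"
    using E by (simp add: is_onb_def orthonormal_def)
  then show ?thesis by blast
qed

lemma orthonormal_some_onb: "orthonormal (some_onb :: 'a::chilbert_space set)"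
  using someI_ex[OF is_onb_exists[where 'a = 'a]]
  by (auto simp: some_onb_def is_onb_def orthonormal_def)

section \<open>Contractive families\<close>

text \<open>Equivalently, \<open>a \<mapsto> \<Sum>\<^sub>e a\<^sub>e u\<^sub>e\<close> is a contraction from \<open>l\<^sup>2(F)\<close>; testing against these families
  replaces the partial isometry of the polar decomposition.\<close>

definition contractive :: "'e set \<Rightarrow> ('e \<Rightarrow> 'a::complex_inner) \<Rightarrow> bool" where
  "contractive F u \<longleftrightarrow> (\<forall>a. norm (\<Sum>e\<in>F. a e *\<^sub>C u e) \<le> L2_set (\<lambda>e. cmod (a e)) F)"

lemma norm_sq_sum_orthonormal:
  assumes E: "orthonormal E" and "finite F" "F \<subseteq> E"
  shows "(norm (\<Sum>e\<in>F. a e *\<^sub>C e))\<^sup>2 = (\<Sum>e\<in>F. (cmod (a e))\<^sup>2)"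
  using assms(2,3)
proof (induction F rule: finite_induct)
  case (insert x F)
  have "cinner x e = 0" if "e \<in> F" for e
    using E insert that by (metis insert_subset orthonormal_def subsetD)
  then have "cinner x (\<Sum>e\<in>F. a e *\<^sub>C e) = 0"
    by (simp add: cinner_sum_right cinner_scaleC_right)
  moreover have "norm x = 1" using E insert by (auto simp: orthonormal_def)
  ultimately show ?case
    using insert by (simp add: norm_add_sq cinner_scaleC_left norm_scaleC)
qed simp

lemma contractive_orthonormal:
  assumes "orthonormal E" "finite F" "F \<subseteq> E"
  shows "contractive F (\<lambda>e. e)"
  unfolding contractive_def L2_set_def
  by (intro allI real_le_rsqrt) (simp add: norm_sq_sum_orthonormal[OF assms])

text \<open>With coefficients \<open>cinner x (u e)\<close>, pairing \<open>x\<close> with the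
  combination of the \<open>u e\<close> yields the square of the left side, and contractivity bounds
  the norm of that combination by the left side itself. One factor cancels.\<close>

lemma contractive_bessel:
  assumes u: "contractive F u"
  shows "L2_set (\<lambda>e. cmod (cinner x (u e))) F \<le> norm x"
proof -
  define s where "s = L2_set (\<lambda>e. cmod (cinner x (u e))) F"
  have s0: "0 \<le> s" by (simp add: s_def L2_set_nonneg)
  have "s\<^sup>2 = (\<Sum>e\<in>F. (cmod (cinner x (u e)))\<^sup>2)"
    by (simp add: s_def L2_set_def sum_nonneg)
  also have "complex_of_real \<dots> = cinner x (\<Sum>e\<in>F. cinner x (u e) *\<^sub>C u e)"
    unfolding of_real_sum complex_norm_square
    by (simp add: cinner_sum_right cinner_scaleC_right mult_ac)
  finally have "s\<^sup>2 = cmod (cinner x (\<Sum>e\<in>F. cinner x (u e) *\<^sub>C u e))"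
    by (metis abs_power2 norm_of_real)
  also have "\<dots> \<le> norm x * norm (\<Sum>e\<in>F. cinner x (u e) *\<^sub>C u e)"
    by (rule norm_cinner_le)
  also have "\<dots> \<le> norm x * s"
    unfolding s_def using u by (intro mult_left_mono) (auto simp: contractive_def)
  finally have "s * s \<le> norm x * s" by (simp add: power2_eq_square)
  then show ?thesis
    using s0 by (cases "s = 0") (auto simp flip: s_def)
qed

section \<open>The positive square root\<close>

text \<open>With \<open>X = 1 - T\<^sup>* T\<close> and \<open>\<parallel>T\<parallel> \<le> 1\<close>, the limit \<open>Y\<close> of the iteration satisfies
  \<open>Y = (X + Y\<^sup>2) / 2\<close>, that is, \<open>(1 - Y)\<^sup>2 = 1 - X\<close>.\<close>

fun sqrt_iter :: "('a::complex_inner \<Rightarrow> 'a) \<Rightarrow> nat \<Rightarrow> 'a \<Rightarrow> 'a" where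
  "sqrt_iter X 0 x = 0"
| "sqrt_iter X (Suc n) x = (1/2::real) *\<^sub>R (X x + sqrt_iter X n (sqrt_iter X n x))"

text \<open>The same iteration for \<open>X = 1\<close>; it dominates the increments of the operator iteration.\<close>

fun scalar_iter :: "nat \<Rightarrow> real" where
  "scalar_iter 0 = 0"
| "scalar_iter (Suc n) = (1 + (scalar_iter n)\<^sup>2) / 2"

lemma scalar_iter_bounds: "0 \<le> scalar_iter n \<and> scalar_iter n \<le> 1"
  by (induction n) (auto simp: power_le_one)

text \<open>The increment equals \<open>(1 - scalar_iter n)\<^sup>2 / 2\<close>.\<close>

lemma scalar_iter_Suc_ge: "scalar_iter n \<le> scalar_iter (Suc n)"
proof -
  have "0 \<le> (1 - scalar_iter n)\<^sup>2" by simp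
  then show ?thesis by (simp add: power2_eq_square field_simps)
qed

lemma scalar_iter_Cauchy: "Cauchy scalar_iter"
proof -
  have "incseq scalar_iter"
    by (intro incseq_SucI scalar_iter_Suc_ge)
  moreover have "scalar_iter i \<le> 1" for i
    using scalar_iter_bounds by blast
  ultimately show ?thesis
    using incseq_convergent[of scalar_iter 1] LIMSEQ_imp_Cauchy by metis
qed

context
  fixes X :: "'a::chilbert_space \<Rightarrow> 'a"
  assumes X: "bounded_clinear X" and X_le: "\<And>x. norm (X x) \<le> norm x"
    and X_sym: "\<And>x y. cinner (X x) y = cinner x (X y)"
begin

lemma sqrt_iter_linear:
  "sqrt_iter X n (x + y) = sqrt_iter X n x + sqrt_iter X n y"
  "sqrt_iter X n (c *\<^sub>C x) = c *\<^sub>C sqrt_iter X n x"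
proof (induction n arbitrary: x y c)
  case (Suc n)
  {
    case 1 then show ?case
      by (simp add: Suc bounded_clinearD[OF X] algebra_simps)
  next
    case 2 then show ?case
      by (simp add: Suc bounded_clinearD[OF X] scaleR_scaleC[where 'a = 'a] scaleC_add_right
          scaleC_scaleC mult_ac)
  }
qed simp_all

lemma sqrt_iter_diff: "sqrt_iter X n (x - y) = sqrt_iter X n x - sqrt_iter X n y"
  using sqrt_iter_linear(1)[of n "x - y" y] by simp

lemma norm_sqrt_iter_le: "norm (sqrt_iter X n x) \<le> scalar_iter n * norm x"
proof (induction n arbitrary: x)
  case (Suc n)
  have "norm (sqrt_iter X n (sqrt_iter X n x)) \<le> scalar_iter n * (scalar_iter n * norm x)"
    by (rule order_trans[OF Suc mult_left_mono[OF Suc]]) (use scalar_iter_bounds in blast)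
  then have "norm (X x + sqrt_iter X n (sqrt_iter X n x)) \<le> norm x + (scalar_iter n)\<^sup>2 * norm x"
    using norm_triangle_ineq[of "X x" "sqrt_iter X n (sqrt_iter X n x)"] X_le[of x]
    by (simp add: power2_eq_square mult_ac)
  then show ?case by (simp add: distrib_right)
qed simp

lemma norm_sqrt_iter_le': "norm (sqrt_iter X n x) \<le> norm x"
  using norm_sqrt_iter_le[of n x] scalar_iter_bounds[of n]
  by (meson mult_left_le_one_le norm_ge_zero order_trans)

lemma sqrt_iter_sym: "cinner (sqrt_iter X n x) y = cinner x (sqrt_iter X n y)"
  by (induction n arbitrary: x y)
     (simp_all add: cinner_scaleR_left cinner_scaleR_right cinner_add_left cinner_add_right X_sym)

text \<open>With \<open>Y'\<close> for the iterate after \<open>Y\<close>, the difference of squares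
  is split as \<open>(Y' - Y) Y' + Y (Y' - Y)\<close>, an identity that holds without commutativity.
  The scalar iteration satisfies the same recursion with equality, so the induction closes without
  loss.\<close>

lemma norm_sqrt_iter_Suc_diff:
  "norm (sqrt_iter X (Suc n) x - sqrt_iter X n x) \<le> (scalar_iter (Suc n) - scalar_iter n) * norm x"
proof (induction n arbitrary: x)
  case 0
  show ?case using X_le[of x] by simp
next
  case (Suc n)
  let ?Y = "sqrt_iter X" and ?y = scalar_iter
  let ?d = "?y (Suc n) - ?y n"
  have d: "0 \<le> ?d" using scalar_iter_Suc_ge[of n] by linarith
  define u where "u = ?Y (Suc n) (?Y (Suc n) x) - ?Y n (?Y (Suc n) x)"
  define v where "v = ?Y n (?Y (Suc n) x - ?Y n x)"
  have "?Y (Suc (Suc n)) x - ?Y (Suc n) x =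
      (1/2) *\<^sub>R (X x + ?Y (Suc n) (?Y (Suc n) x)) - (1/2) *\<^sub>R (X x + ?Y n (?Y n x))"
    by (rule arg_cong2[where f = "(-)"]; rule sqrt_iter.simps(2))
  also have "\<dots> = (1/2) *\<^sub>R (u + v)"
    unfolding u_def v_def sqrt_iter_diff by (simp add: scaleR_right_distrib scaleR_diff_right del: sqrt_iter.simps)
  finally have eq: "?Y (Suc (Suc n)) x - ?Y (Suc n) x = (1/2) *\<^sub>R (u + v)" .
  have u: "norm u \<le> ?d * (?y (Suc n) * norm x)"
    unfolding u_def by (rule order_trans[OF Suc mult_left_mono[OF norm_sqrt_iter_le d]])
  have v: "norm v \<le> ?y n * (?d * norm x)"
    unfolding v_def by (rule order_trans[OF norm_sqrt_iter_le mult_left_mono[OF Suc]])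
       (use scalar_iter_bounds in blast)
  have "norm (?Y (Suc (Suc n)) x - ?Y (Suc n) x)
      \<le> (?d * (?y (Suc n) * norm x) + ?y n * (?d * norm x)) / 2"
    unfolding eq using u v norm_triangle_ineq[of u v] by (simp del: scalar_iter.simps)
  also have "\<dots> = (?y (Suc (Suc n)) - ?y (Suc n)) * norm x"
    unfolding scalar_iter.simps(2)[of "Suc n"] scalar_iter.simps(2)[of n]
    by (simp add: field_simps power2_eq_square)
  finally show ?case .
qed

lemma norm_sqrt_iter_diff:
  "m \<le> n \<Longrightarrow> norm (sqrt_iter X n x - sqrt_iter X m x) \<le> (scalar_iter n - scalar_iter m) * norm x"
proof (induction n rule: dec_induct)
  case (step n)
  show ?case
    using norm_triangle_ineq[of "sqrt_iter X (Suc n) x - sqrt_iter X n x" "sqrt_iter X n x - sqrt_iter X m x"]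
      norm_sqrt_iter_Suc_diff[of n x] step.IH
    by (simp add: algebra_simps)
qed simp

lemma sqrt_iter_convergent: "convergent (\<lambda>n. sqrt_iter X n x)"
proof -
  have "Cauchy (\<lambda>n. sqrt_iter X n x)"
  proof (rule metric_CauchyI)
    fix e :: real assume e: "0 < e"
    \<comment> \<open>Adding 1 keeps the divisor positive when \<open>x = 0\<close>.\<close>
    have pos: "0 < norm x + 1" using norm_ge_zero[of x] by linarith
    then obtain N where N: "\<And>m n. m \<ge> N \<Longrightarrow> n \<ge> N \<Longrightarrow> dist (scalar_iter m) (scalar_iter n) < e / (norm x + 1)"
      using metric_CauchyD[OF scalar_iter_Cauchy, of "e / (norm x + 1)"] e by auto
    have *: "dist (sqrt_iter X n x) (sqrt_iter X m x) < e" if "N \<le> m" "m \<le> n" for m n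
    proof -
      have "dist (sqrt_iter X n x) (sqrt_iter X m x) \<le> (scalar_iter n - scalar_iter m) * norm x"
        unfolding dist_norm by (rule norm_sqrt_iter_diff[OF that(2)])
      also have "\<dots> \<le> dist (scalar_iter n) (scalar_iter m) * (norm x + 1)"
        by (intro mult_mono) (auto simp: dist_real_def)
      also have "\<dots> < e"
        using N[of n m] that pos by (simp add: field_simps)
      finally show ?thesis .
    qed
    have "dist (sqrt_iter X m x) (sqrt_iter X n x) < e" if "N \<le> m" "N \<le> n" for m n
      using *[of m n] *[of n m] that by (cases "m \<le> n") (auto simp: dist_commute)
    then show "\<exists>M. \<forall>m\<ge>M. \<forall>n\<ge>M. dist (sqrt_iter X m x) (sqrt_iter X n x) < e" by blast
  qed
  then show ?thesis by (rule Cauchy_convergent)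
qed

text \<open>The root is \<open>1 - Y\<close>, and squaring it is the fixed point equation
  \<open>2 Y = X + Y\<^sup>2\<close> rearranged. Its form is real because \<open>Y\<close> is
  symmetric and nonnegative because \<open>Y\<close> is a contraction.\<close>

lemma positive_sqrt_one_minus: "\<exists>P. positive_op P \<and> (\<forall>x. P (P x) = x - X x)"
proof -
  define Y where "Y x = lim (\<lambda>n. sqrt_iter X n x)" for x
  have lim: "(\<lambda>n. sqrt_iter X n x) \<longlonglongrightarrow> Y x" for x
    unfolding Y_def using sqrt_iter_convergent convergent_LIMSEQ_iff by blast
  have Y_le: "norm (Y x) \<le> norm x" for x
    by (rule tendsto_upperbound[OF tendsto_norm[OF lim]])
       (auto intro: always_eventually norm_sqrt_iter_le')
  have Y_add: "Y (x + y) = Y x + Y y" for x y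
    using LIMSEQ_unique[OF lim[of "x + y"]] tendsto_add[OF lim[of x] lim[of y]]
    by (simp add: sqrt_iter_linear)
  have Y_scale: "Y (c *\<^sub>C x) = c *\<^sub>C Y x" for x c
    using LIMSEQ_unique[OF lim[of "c *\<^sub>C x"]] tendsto_scaleC_right[OF lim[of x], of c]
    by (simp add: sqrt_iter_linear)
  have Y_sym: "cinner (Y x) y = cinner x (Y y)" for x y
    using LIMSEQ_unique[OF tendsto_cinner_left[OF lim[of x], of y]
        tendsto_cinner_right[OF lim[of y], of x, folded sqrt_iter_sym]] .
  \<comment> \<open>Operator and argument vary together. All iterates are contractions, so replacing
    the inner iterate by its limit costs an error tending to 0.\<close>
  have YY: "(\<lambda>n. sqrt_iter X n (sqrt_iter X n x)) \<longlonglongrightarrow> Y (Y x)" for x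
  proof -
    have "(\<lambda>n. sqrt_iter X n (sqrt_iter X n x - Y x)) \<longlonglongrightarrow> 0"
    proof (rule Lim_null_comparison[OF always_eventually])
      show "(\<lambda>n. norm (sqrt_iter X n x - Y x)) \<longlonglongrightarrow> 0"
        using lim[of x] by (simp add: LIM_zero tendsto_norm_zero)
    qed (use norm_sqrt_iter_le' in blast)
    from tendsto_add[OF this lim[of "Y x"]] show ?thesis
      by (simp add: sqrt_iter_diff)
  qed
  have fix_eq: "Y x = (1/2) *\<^sub>R (X x + Y (Y x))" for x
  proof (rule LIMSEQ_unique)
    show "(\<lambda>n. sqrt_iter X (Suc n) x) \<longlonglongrightarrow> Y x"
      using lim[of x] by (rule LIMSEQ_Suc)
    show "(\<lambda>n. sqrt_iter X (Suc n) x) \<longlonglongrightarrow> (1/2) *\<^sub>R (X x + Y (Y x))"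
      unfolding sqrt_iter.simps(2)
      by (intro tendsto_scaleR tendsto_add tendsto_const YY)
  qed
  define P where "P x = x - Y x" for x
  have "bounded_clinear P"
  proof (rule bounded_clinear_intro[where M = 2])
    show "norm (P x) \<le> 2 * norm x" for x
      using norm_triangle_ineq4[of x "Y x"] Y_le[of x] by (simp add: P_def)
  qed (simp_all add: P_def Y_add Y_scale scaleC_diff_right)
  moreover have "cinner (P x) x \<in> \<real> \<and> 0 \<le> Re (cinner (P x) x)" for x
  proof
    have "cinner (Y x) x = cnj (cinner (Y x) x)"
      by (metis Y_sym cinner_commute)
    then have "Im (cinner (P x) x) = 0"
      by (simp add: P_def cinner_diff_left Im_cinner_self complex_eq_iff)
    then show "cinner (P x) x \<in> \<real>"
      by (simp add: complex_is_Real_iff)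
    have "Re (cinner (Y x) x) \<le> norm (Y x) * norm x"
      by (rule order_trans[OF complex_Re_le_cmod norm_cinner_le])
    also have "\<dots> \<le> norm x * norm x"
      by (intro mult_right_mono Y_le) simp
    finally show "0 \<le> Re (cinner (P x) x)"
      by (simp add: P_def cinner_diff_left power2_eq_square flip: norm_sq_cinner)
  qed
  moreover have "P (P x) = x - X x" for x
  proof -
    have "P (P x) = x - Y x - Y x + Y (Y x)"
      using Y_add[of "x - Y x" "Y x"] by (simp add: P_def algebra_simps)
    also have "\<dots> = x - X x"
      using arg_cong[OF fix_eq[of x], of "\<lambda>z. 2 *\<^sub>R z"]
      by (simp add: scaleR_2 algebra_simps)
    finally show ?thesis .
  qed
  ultimately show ?thesis
    unfolding positive_op_def by blast
qed

end

text \<open>Polarisation: a form that is real at \<open>x + y\<close> is constrained in the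
  imaginary parts of its cross terms, and at \<open>x + \<i> *\<^sub>C y\<close> in their real
  parts. Together this makes one cross term the conjugate of the other.\<close>

lemma positive_op_sym:
  assumes P: "positive_op P"
  shows "cinner (P x) y = cinner x (P y)"
proof -
  have lin: "bounded_clinear P" and re: "Im (cinner (P z) z) = 0" for z
    using P by (auto simp: positive_op_def complex_is_Real_iff)
  define a b where "a = cinner (P x) y" and "b = cinner (P y) x"
  have "Im (a + b) = 0"
    using re[of "x + y"] re[of x] re[of y]
    by (simp add: bounded_clinearD[OF lin] cinner_add_left cinner_add_right a_def b_def)
  moreover have "Im (- \<i> * a + \<i> * b) = 0"
    using re[of "x + \<i> *\<^sub>C y"] re[of x] re[of y]
    by (simp add: bounded_clinearD[OF lin] cinner_add_left cinner_add_right cinner_scaleC_left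
        cinner_scaleC_right a_def b_def)
  ultimately have "a = cnj b"
    by (simp add: complex_eq_iff)
  then show ?thesis
    by (simp add: a_def b_def flip: cinner_commute)
qed

lemma
  fixes T :: "'a::chilbert_space \<Rightarrow> 'b::complex_inner"
  assumes T: "bounded_clinear T"
  shows positive_abs_op: "positive_op (abs_op T)"
    and abs_op_square: "abs_op T (abs_op T x) = cadjoint T (T x)"
proof -
  obtain M where M: "M > 0" "\<And>x. norm (T x) \<le> M * norm x"
    using bounded_clinear_bound[OF T] by blast
  note T' = bounded_clinear_cadjoint[OF T]
  \<comment> \<open>Dividing by \<open>M\<^sup>2\<close> places \<open>A\<close> between 0 and 1,
    which makes \<open>X = 1 - A\<close> a contraction as the iteration requires.\<close>
  define A where "A x = complex_of_real (1 / M\<^sup>2) *\<^sub>C cadjoint T (T x)" for x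
  define X where "X x = x - A x" for x
  have X_le: "norm (X x) \<le> norm x" for x
  proof -
    have "norm (A x) \<le> norm (T x) / M"
      using norm_cadjoint_le[OF T M(2), of "T x"] M(1)
      by (simp add: A_def norm_scaleC norm_divide norm_power norm_mult field_simps power2_eq_square)
    then have "(norm (A x))\<^sup>2 \<le> (norm (T x))\<^sup>2 / M\<^sup>2"
      using M(1) by (metis norm_ge_zero power_divide power_mono)
    moreover have "Re (cinner x (A x)) = (norm (T x))\<^sup>2 / M\<^sup>2"
      by (simp add: A_def cinner_scaleC_right cinner_self Re_divide_of_real
          flip: cadjoint[OF T] of_real_power)
    moreover have "0 \<le> (norm (T x))\<^sup>2 / M\<^sup>2" by simp
    \<comment> \<open>In the expansion of the square, twice the inner product of \<open>x\<close>
      with \<open>A x\<close> outweighs \<open>(norm (A x))\<^sup>2\<close>, since the latter is at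
      most that inner product.\<close>
    ultimately have "(norm (X x))\<^sup>2 \<le> (norm x)\<^sup>2"
      unfolding X_def norm_diff_sq by linarith
    then show ?thesis
      by (simp add: power2_le_iff_abs_le)
  qed
  have "bounded_clinear X"
    by (rule bounded_clinear_intro[where M = 1])
       (use X_le in \<open>simp_all add: X_def A_def bounded_clinearD[OF T] bounded_clinearD[OF T']
          scaleC_add_right scaleC_diff_right scaleC_scaleC mult_ac\<close>)
  moreover have "cinner (X x) y = cinner x (X y)" for x y
    by (simp add: X_def A_def cinner_diff_left cinner_diff_right cinner_scaleC_left
        cinner_scaleC_right cadjoint'[OF T] flip: cadjoint[OF T])
  ultimately obtain P where P: "positive_op P" "\<And>x. P (P x) = A x"
    using positive_sqrt_one_minus[of X] X_le by (auto simp: X_def)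
  \<comment> \<open>The factor \<open>M\<close> undoes the scaling: \<open>Q\<close> squares to
    \<open>M\<^sup>2\<close> times \<open>A\<close>.\<close>
  define Q where "Q x = complex_of_real M *\<^sub>C P x" for x
  have lin: "bounded_clinear P" using P(1) by (simp add: positive_op_def)
  have "bounded_clinear Q"
  proof -
    obtain N where N: "\<And>x. norm (P x) \<le> N * norm x"
      using bounded_clinear_bound[OF lin] by blast
    show ?thesis
      by (rule bounded_clinear_intro[where M = "M * N"])
         (use N M(1) in \<open>simp_all add: Q_def bounded_clinearD[OF lin] scaleC_add_right scaleC_scaleC
            mult_ac norm_scaleC\<close>)
  qed
  then have "positive_op Q"
    using P(1) M(1)
    by (auto simp: positive_op_def Q_def cinner_scaleC_left complex_is_Real_iff)
  moreover have "Q \<circ> Q = cadjoint T \<circ> T"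
    using M(1)
    by (auto simp: Q_def bounded_clinearD[OF lin] P(2) A_def scaleC_scaleC power2_eq_square scaleC_one
        simp flip: of_real_mult)
  ultimately have "\<exists>Q. positive_op Q \<and> Q \<circ> Q = cadjoint T \<circ> T" by blast
  then have "positive_op (abs_op T) \<and> abs_op T \<circ> abs_op T = cadjoint T \<circ> T"
    unfolding abs_op_def by (rule someI_ex)
  then show "positive_op (abs_op T)" "abs_op T (abs_op T x) = cadjoint T (T x)"
    by (auto simp: fun_eq_iff)
qed

text \<open>This makes \<open>abs_op T x \<mapsto> T x\<close> a well defined isometry on the range
  of \<open>abs_op T\<close>, the partial isometry of the polar decomposition.\<close>

lemma cinner_abs_op:
  fixes T :: "'a::chilbert_space \<Rightarrow> 'b::complex_inner"
  assumes T: "bounded_clinear T"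
  shows "cinner (abs_op T x) (abs_op T y) = cinner (T x) (T y)"
  by (simp add: positive_op_sym[OF positive_abs_op[OF T]] abs_op_square[OF T] cadjoint[OF T])

lemma norm_abs_op:
  fixes T :: "'a::chilbert_space \<Rightarrow> 'b::complex_inner"
  assumes T: "bounded_clinear T"
  shows "norm (abs_op T x) = norm (T x)"
proof -
  have "(norm (abs_op T x))\<^sup>2 = (norm (T x))\<^sup>2"
    by (simp add: norm_sq_cinner cinner_abs_op[OF T])
  then show ?thesis by (simp add: power2_eq_iff_nonneg)
qed

section \<open>Operator, Hilbert--Schmidt and trace norm bounds\<close>

definition op_bound :: "('a::complex_inner \<Rightarrow> 'b::complex_inner) \<Rightarrow> real \<Rightarrow> bool" where
  "op_bound T M \<longleftrightarrow> bounded_clinear T \<and> 0 \<le> M \<and> (\<forall>x. norm (T x) \<le> M * norm x)"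

text \<open>Finite partial sums make square summability a consequence instead of a side condition,
  and the bound passes to pointwise limits.\<close>

definition hs_bound :: "('a::complex_inner \<Rightarrow> 'b::complex_inner) \<Rightarrow> real \<Rightarrow> bool" where
  "hs_bound T M \<longleftrightarrow> bounded_clinear T \<and>
     (\<forall>F. finite F \<and> F \<subseteq> some_onb \<longrightarrow> L2_set (\<lambda>e. norm (T e)) F \<le> M)"

text \<open>Unlike the trace norm, this condition is visibly subadditive in \<open>T\<close> and stable under
  pointwise limits.\<close>

definition nuclear_bound :: "('a::complex_inner \<Rightarrow> 'b::complex_inner) \<Rightarrow> real \<Rightarrow> bool" where
  "nuclear_bound T M \<longleftrightarrow> bounded_clinear T \<and>
     (\<forall>F u. finite F \<and> F \<subseteq> some_onb \<and> contractive F u \<longrightarrow> cmod (\<Sum>e\<in>F. cinner (T e) (u e)) \<le> M)"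

section \<open>Subadditivity of the three bounds\<close>

lemma bounded_clinear_add:
  assumes "bounded_clinear S" "bounded_clinear T"
  shows "bounded_clinear (\<lambda>x. S x + T x)"
  using assms by (auto simp: bounded_clinear_def bounded_linear_add scaleC_add_right)

lemma op_bound_add:
  assumes "op_bound S a" "op_bound T b"
  shows "op_bound (\<lambda>x. S x + T x) (a + b)"
  using assms unfolding op_bound_def distrib_right
  by (auto intro: bounded_clinear_add norm_triangle_mono)

lemma hs_bound_add:
  assumes "hs_bound S a" "hs_bound T b"
  shows "hs_bound (\<lambda>x. S x + T x) (a + b)"
  unfolding hs_bound_def
proof (intro conjI allI impI)
  fix F :: "'a set" assume F: "finite F \<and> F \<subseteq> some_onb"
  have "L2_set (\<lambda>e. norm (S e + T e)) F \<le> L2_set (\<lambda>e. norm (S e) + norm (T e)) F"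
    by (intro L2_set_mono norm_triangle_ineq) auto
  also have "\<dots> \<le> L2_set (\<lambda>e. norm (S e)) F + L2_set (\<lambda>e. norm (T e)) F"
    by (rule L2_set_triangle_ineq)
  also have "\<dots> \<le> a + b"
    using F assms by (intro add_mono) (auto simp: hs_bound_def)
  finally show "L2_set (\<lambda>e. norm (S e + T e)) F \<le> a + b" .
qed (use assms in \<open>auto simp: hs_bound_def bounded_clinear_add\<close>)

lemma nuclear_bound_add:
  assumes "nuclear_bound S a" "nuclear_bound T b"
  shows "nuclear_bound (\<lambda>x. S x + T x) (a + b)"
  using assms unfolding nuclear_bound_def cinner_add_left sum.distrib
  by (auto intro: bounded_clinear_add norm_triangle_mono)

section \<open>From finite bounds to norms and convergence\<close>

lemma summable_on_infsum_le:
  fixes g :: "'k \<Rightarrow> real"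
  assumes "\<And>k. k \<in> K \<Longrightarrow> 0 \<le> g k" and "\<And>G. finite G \<Longrightarrow> G \<subseteq> K \<Longrightarrow> sum g G \<le> M"
  shows "g summable_on K" "infsum g K \<le> M"
proof -
  show "g summable_on K"
    by (rule nonneg_bdd_above_summable_on) (use assms in \<open>auto intro!: bdd_aboveI[where M = M]\<close>)
  then show "infsum g K \<le> M"
    by (rule infsum_le_finite_sums) (use assms in auto)
qed

lemma op_bound_onorm:
  assumes "op_bound T M"
  shows "bounded_clinear T" "0 \<le> onorm T" "onorm T \<le> M"
  using assms onorm_pos_le[of T] onorm_bound[of M T] by (auto simp: op_bound_def bounded_clinear_def)

lemma hs_bound_hs_norm:
  assumes "hs_bound T M"
  shows "hilbert_schmidt T" "0 \<le> hs_norm T" "hs_norm T \<le> M"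
proof -
  have M: "0 \<le> M" using assms unfolding hs_bound_def by (metis L2_set_empty empty_subsetI finite.emptyI)
  have "(\<Sum>e\<in>F. (norm (T e))\<^sup>2) \<le> M\<^sup>2" if "finite F" "F \<subseteq> some_onb" for F
    using assms that by (auto simp: hs_bound_def L2_set_def intro: sqrt_le_D)
  then have s: "(\<lambda>e. (norm (T e))\<^sup>2) summable_on some_onb" "(\<Sum>\<^sub>\<infinity>e\<in>some_onb. (norm (T e))\<^sup>2) \<le> M\<^sup>2"
    by (auto intro!: summable_on_infsum_le)
  show "hilbert_schmidt T"
    using s assms by (simp add: hilbert_schmidt_def hs_bound_def)
  show "0 \<le> hs_norm T"
    by (simp add: hs_norm_def infsum_nonneg)
  show "hs_norm T \<le> M"
    unfolding hs_norm_def using s(2) M by (simp add: real_le_lsqrt infsum_nonneg)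
qed

lemma nuclear_bound_trace_norm:
  fixes T :: "'a::chilbert_space \<Rightarrow> 'b::chilbert_space"
  assumes nb: "nuclear_bound T M"
  shows "trace_class T" "0 \<le> trace_norm T" "trace_norm T \<le> M"
proof -
  have T: "bounded_clinear T" using nb by (simp add: nuclear_bound_def)
  define P where "P = abs_op T"
  have pos: "positive_op P" unfolding P_def by (rule positive_abs_op[OF T])
  then have P: "bounded_clinear P" by (simp add: positive_op_def)
  \<comment> \<open>The range of \<open>P\<close> need not be closed, and only on its closure is
    there a projection. The isometry \<open>P x \<mapsto> T x\<close> is extended to this closure
    along sequences.\<close>
  define R where "R = closure (range P)"
  have "csubspace (range P)"
    unfolding csubspace_def
    by (auto simp: image_iff) (metis bounded_clinearD(2,4,5)[OF P])+
  then have R: "csubspace R" unfolding R_def by (rule csubspace_closure)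
  have "\<exists>p\<in>R. \<forall>y\<in>R. cinner (e - p) y = 0" for e
    using orthogonal_projection[OF R, of e] by (metis R_def closed_closure)
  then obtain p where pR: "\<And>e. p e \<in> R" and p: "\<And>e y. y \<in> R \<Longrightarrow> cinner (e - p e) y = 0"
    by metis
  have "\<exists>x. (\<lambda>n. P (x n)) \<longlonglongrightarrow> p e" for e
  proof -
    obtain f where "\<And>n. f n \<in> range P" "f \<longlonglongrightarrow> p e"
      using pR[of e] unfolding R_def closure_sequential by blast
    then have "\<And>n. P (inv P (f n)) = f n" "f \<longlonglongrightarrow> p e" by (auto simp: f_inv_into_f)
    then show ?thesis by (intro exI[of _ "\<lambda>n. inv P (f n)"]) simp
  qed
  then obtain x where x: "\<And>e. (\<lambda>n. P (x e n)) \<longlonglongrightarrow> p e" by metis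
  \<comment> \<open>\<open>T\<close> and \<open>P\<close> have equal norms on differences, so
    convergence of \<open>P (x e n)\<close> forces that of \<open>T (x e n)\<close>. The limit
    \<open>u e\<close> is the image of \<open>p e\<close> under the extended isometry.\<close>
  have "convergent (\<lambda>n. T (x e n))" for e
  proof -
    have "dist (T (x e m)) (T (x e n)) = dist (P (x e m)) (P (x e n))" for m n
      using norm_abs_op[OF T, of "x e m - x e n"]
      by (simp add: dist_norm bounded_clinearD[OF T] bounded_clinearD[OF P] flip: P_def)
    then have "Cauchy (\<lambda>n. T (x e n))"
      using LIMSEQ_imp_Cauchy[OF x[of e]] by (simp add: Cauchy_def)
    then show ?thesis by (rule Cauchy_convergent)
  qed
  then obtain u where u: "\<And>e. (\<lambda>n. T (x e n)) \<longlonglongrightarrow> u e"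
    unfolding convergent_def by metis
  have contr: "contractive F u" if F: "finite F" "F \<subseteq> some_onb" for F
    unfolding contractive_def
  proof
    fix a :: "'a \<Rightarrow> complex"
    define q where "q = (\<Sum>e\<in>F. a e *\<^sub>C p e)"
    define w where "w = (\<Sum>e\<in>F. a e *\<^sub>C e)"
    \<comment> \<open>The extended isometry preserves the norm of the combination: both sides are
      limits of the same sequence, read once through \<open>T\<close> and once through
      \<open>P\<close>.\<close>
    have "norm (\<Sum>e\<in>F. a e *\<^sub>C u e) = norm q"
    proof (rule LIMSEQ_unique)
      show "(\<lambda>n. norm (T (\<Sum>e\<in>F. a e *\<^sub>C x e n))) \<longlonglongrightarrow> norm (\<Sum>e\<in>F. a e *\<^sub>C u e)"
        unfolding bounded_clinearD[OF T]
        by (intro tendsto_norm tendsto_sum tendsto_scaleC_right u)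
      show "(\<lambda>n. norm (T (\<Sum>e\<in>F. a e *\<^sub>C x e n))) \<longlonglongrightarrow> norm q"
        unfolding norm_abs_op[OF T, symmetric] P_def[symmetric] bounded_clinearD[OF P] q_def
        by (intro tendsto_norm tendsto_sum tendsto_scaleC_right x)
    qed
    also have "q \<in> R"
      unfolding q_def by (intro csubspace_sum[OF R]) (use R pR in \<open>auto simp: csubspace_def\<close>)
    \<comment> \<open>\<open>q\<close> is the projection of \<open>w\<close> onto \<open>R\<close>,
      so Pythagoras gives that it is no longer than \<open>w\<close>.\<close>
    then have "cinner (w - q) q = 0"
      by (simp add: w_def q_def cinner_sum_left cinner_scaleC_left p flip: sum_subtractf scaleC_diff_right)
    then have "(norm w)\<^sup>2 = (norm (w - q))\<^sup>2 + (norm q)\<^sup>2"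
      using norm_add_sq[of "w - q" q] by simp
    then have "norm q \<le> norm w"
      by (simp add: power2_le_imp_le)
    also have "\<dots> \<le> L2_set (\<lambda>e. cmod (a e)) F"
      using contractive_orthonormal[OF orthonormal_some_onb F] by (simp add: contractive_def w_def)
    finally show "norm (\<Sum>e\<in>F. a e *\<^sub>C u e) \<le> L2_set (\<lambda>e. cmod (a e)) F" .
  qed
  \<comment> \<open>Replacing \<open>p e\<close> by \<open>e\<close> is harmless because
    \<open>e - p e\<close> is orthogonal to the range of \<open>P\<close>.\<close>
  have eq: "cinner (T e) (u e) = cinner (P e) e" for e
  proof -
    have "cinner (T e) (u e) = cinner (P e) (p e)"
    proof (rule LIMSEQ_unique)
      show "(\<lambda>n. cinner (T e) (T (x e n))) \<longlonglongrightarrow> cinner (T e) (u e)"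
        by (intro tendsto_cinner_right u)
      show "(\<lambda>n. cinner (T e) (T (x e n))) \<longlonglongrightarrow> cinner (P e) (p e)"
        unfolding cinner_abs_op[OF T, symmetric] P_def[symmetric]
        by (intro tendsto_cinner_right x)
    qed
    moreover have "cinner (e - p e) (P e) = 0"
      by (rule p) (simp add: R_def closure_subset[THEN subsetD])
    then have "cinner (P e) (e - p e) = 0"
      by (subst cinner_commute) simp
    ultimately show ?thesis by (simp add: cinner_diff_right)
  qed
  have nonneg: "0 \<le> Re (cinner (P e) e)" for e
    using pos by (simp add: positive_op_def)
  have "(\<Sum>e\<in>F. Re (cinner (P e) e)) \<le> M" if F: "finite F" "F \<subseteq> some_onb" for F
  proof -
    have "(\<Sum>e\<in>F. Re (cinner (P e) e)) = Re (\<Sum>e\<in>F. cinner (T e) (u e))"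
      by (simp add: eq)
    also have "\<dots> \<le> M"
      using nb F contr[OF F] complex_Re_le_cmod order_trans unfolding nuclear_bound_def by blast
    finally show ?thesis .
  qed
  then have s: "(\<lambda>e. Re (cinner (P e) e)) summable_on some_onb"
      "(\<Sum>\<^sub>\<infinity>e\<in>some_onb. Re (cinner (P e) e)) \<le> M"
    using nonneg by (auto intro!: summable_on_infsum_le)
  then show "trace_class T" "trace_norm T \<le> M"
    using T by (auto simp: trace_class_def trace_norm_def P_def)
  show "0 \<le> trace_norm T"
    using nonneg by (auto simp: trace_norm_def P_def intro: infsum_nonneg)
qed

text \<open>\<open>h\<close> turns the tolerance in the data into a bound on the error. Perturbing
  three entries at once yields a polynomial in the tolerance, so a general \<open>h\<close>
  vanishing at 0 is allowed.\<close>

lemma tendsto_zero_if_bounded: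
  fixes g :: "nat \<Rightarrow> real"
  assumes h: "(h \<longlongrightarrow> 0) (at_right 0)"
    and g: "\<And>\<eta>::real. 0 < \<eta> \<Longrightarrow> \<forall>\<^sub>F l in sequentially. 0 \<le> g l \<and> g l \<le> h \<eta>"
  shows "g \<longlonglongrightarrow> 0"
proof (rule tendstoI)
  fix r :: real assume "0 < r"
  then have "\<forall>\<^sub>F \<eta> in at_right 0. h \<eta> < r"
    using h by (rule order_tendstoD(2)[rotated])
  then obtain b where b: "0 < b" "\<And>\<eta>. 0 < \<eta> \<Longrightarrow> \<eta> < b \<Longrightarrow> h \<eta> < r"
    unfolding eventually_at_right_field by blast
  have "\<forall>\<^sub>F l in sequentially. 0 \<le> g l \<and> g l \<le> h (b / 2)"
    using b(1) by (intro g) simp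
  then show "\<forall>\<^sub>F l in sequentially. dist (g l) 0 < r"
    by eventually_elim (use b(1) b(2)[of "b / 2"] in auto)
qed

lemma converges_op_if_bounded:
  assumes "(h \<longlongrightarrow> 0) (at_right 0)"
    and b: "\<And>\<eta>::real. 0 < \<eta> \<Longrightarrow> \<forall>\<^sub>F l in sequentially. op_bound (\<lambda>f. S l f - T f) (h \<eta>)"
  shows "converges_op S T"
  unfolding converges_op_def
proof
  show "\<forall>\<^sub>F l in sequentially. bounded_clinear (\<lambda>f. S l f - T f)"
    using b[OF zero_less_one] by eventually_elim (rule op_bound_onorm)
  show "(\<lambda>l. onorm (\<lambda>f. S l f - T f)) \<longlonglongrightarrow> 0"
  proof (rule tendsto_zero_if_bounded[OF assms(1)])
    show "\<forall>\<^sub>F l in sequentially. 0 \<le> onorm (\<lambda>f. S l f - T f) \<and> onorm (\<lambda>f. S l f - T f) \<le> h \<eta>"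
      if "0 < \<eta>" for \<eta>
      using b[OF that] by eventually_elim (simp add: op_bound_onorm)
  qed
qed

lemma converges_hs_if_bounded:
  assumes "(h \<longlongrightarrow> 0) (at_right 0)"
    and b: "\<And>\<eta>::real. 0 < \<eta> \<Longrightarrow> \<forall>\<^sub>F l in sequentially. hs_bound (\<lambda>f. S l f - T f) (h \<eta>)"
  shows "converges_hs S T"
  unfolding converges_hs_def
proof
  show "\<forall>\<^sub>F l in sequentially. hilbert_schmidt (\<lambda>f. S l f - T f)"
    using b[OF zero_less_one] by eventually_elim (rule hs_bound_hs_norm)
  show "(\<lambda>l. hs_norm (\<lambda>f. S l f - T f)) \<longlonglongrightarrow> 0"
  proof (rule tendsto_zero_if_bounded[OF assms(1)])
    show "\<forall>\<^sub>F l in sequentially. 0 \<le> hs_norm (\<lambda>f. S l f - T f) \<and> hs_norm (\<lambda>f. S l f - T f) \<le> h \<eta>"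
      if "0 < \<eta>" for \<eta>
      using b[OF that] by eventually_elim (simp add: hs_bound_hs_norm)
  qed
qed

lemma converges_trace_if_bounded:
  fixes T :: "'a::chilbert_space \<Rightarrow> 'b::chilbert_space"
  assumes "(h \<longlongrightarrow> 0) (at_right 0)"
    and b: "\<And>\<eta>::real. 0 < \<eta> \<Longrightarrow> \<forall>\<^sub>F l in sequentially. nuclear_bound (\<lambda>f. S l f - T f) (h \<eta>)"
  shows "converges_trace S T"
  unfolding converges_trace_def
proof
  show "\<forall>\<^sub>F l in sequentially. trace_class (\<lambda>f. S l f - T f)"
    using b[OF zero_less_one] by eventually_elim (rule nuclear_bound_trace_norm)
  show "(\<lambda>l. trace_norm (\<lambda>f. S l f - T f)) \<longlonglongrightarrow> 0"
  proof (rule tendsto_zero_if_bounded[OF assms(1)])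
    show "\<forall>\<^sub>F l in sequentially. 0 \<le> trace_norm (\<lambda>f. S l f - T f) \<and> trace_norm (\<lambda>f. S l f - T f) \<le> h \<eta>"
      if "0 < \<eta>" for \<eta>
      using b[OF that] by eventually_elim (simp add: nuclear_bound_trace_norm)
  qed
qed

section \<open>Bessel sequences\<close>

text \<open>In this form, with finite sums and roots, Bessel bounds can be handled by the Minkowski
  and Cauchy--Schwarz inequalities for \<open>L2_set\<close>.\<close>

lemma bessel_bound_iff:
  "bessel_bound K \<psi> B \<longleftrightarrow> 0 < B \<and>
     (\<forall>f G. finite G \<longrightarrow> G \<subseteq> K \<longrightarrow> L2_set (\<lambda>k. cmod (cinner f (\<psi> k))) G \<le> sqrt B * norm f)"
proof -
  have iff: "L2_set (\<lambda>k. cmod (cinner f (\<psi> k))) G \<le> sqrt B * norm f \<longleftrightarrow>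
      (\<Sum>k\<in>G. (cmod (cinner f (\<psi> k)))\<^sup>2) \<le> B * (norm f)\<^sup>2" if "0 < B" for f G
  proof -
    have "sqrt B * norm f = sqrt (B * (norm f)\<^sup>2)"
      by (simp add: real_sqrt_mult)
    then show ?thesis by (simp only: L2_set_def real_sqrt_le_iff)
  qed
  have "(\<Sum>k\<in>G. (cmod (cinner f (\<psi> k)))\<^sup>2) \<le> B * (norm f)\<^sup>2"
    if "bessel_bound K \<psi> B" "finite G" "G \<subseteq> K" for f G
    using that order_trans[OF finite_sum_le_infsum[of "\<lambda>k. (cmod (cinner f (\<psi> k)))\<^sup>2" K G]]
    by (simp add: bessel_bound_def)
  moreover have "bessel_bound K \<psi> B"
    if "0 < B" "\<And>f G. finite G \<Longrightarrow> G \<subseteq> K \<Longrightarrow> (\<Sum>k\<in>G. (cmod (cinner f (\<psi> k)))\<^sup>2) \<le> B * (norm f)\<^sup>2"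
    using that summable_on_infsum_le[of K "\<lambda>k. (cmod (cinner f (\<psi> k)))\<^sup>2" "B * (norm f)\<^sup>2" for f]
    by (auto simp: bessel_bound_def)
  ultimately show ?thesis
    using iff by (metis bessel_bound_def)
qed

lemma bessel_bound_L2:
  assumes "bessel_bound K \<psi> B" "finite G" "G \<subseteq> K"
  shows "L2_set (\<lambda>k. cmod (cinner f (\<psi> k))) G \<le> sqrt B * norm f"
  using assms by (simp add: bessel_bound_iff)

lemma bessel_bound_add:
  assumes "bessel_bound K \<psi> (a\<^sup>2)" "bessel_bound K \<delta> (b\<^sup>2)" and "0 < a" "0 < b"
  shows "bessel_bound K (\<lambda>k. \<psi> k + \<delta> k) ((a + b)\<^sup>2)"
  unfolding bessel_bound_iff
proof (intro conjI allI impI)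
  fix f :: 'b and G assume G: "finite G" "G \<subseteq> K"
  have "L2_set (\<lambda>k. cmod (cinner f (\<psi> k + \<delta> k))) G
      \<le> L2_set (\<lambda>k. cmod (cinner f (\<psi> k)) + cmod (cinner f (\<delta> k))) G"
    by (intro L2_set_mono) (auto simp: cinner_add_right norm_triangle_ineq)
  also have "\<dots> \<le> L2_set (\<lambda>k. cmod (cinner f (\<psi> k))) G + L2_set (\<lambda>k. cmod (cinner f (\<delta> k))) G"
    by (rule L2_set_triangle_ineq)
  also have "\<dots> \<le> a * norm f + b * norm f"
    using bessel_bound_L2[OF assms(1) G, of f] bessel_bound_L2[OF assms(2) G, of f] assms(3,4)
    by (simp add: real_sqrt_abs)
  finally show "L2_set (\<lambda>k. cmod (cinner f (\<psi> k + \<delta> k))) G \<le> sqrt ((a + b)\<^sup>2) * norm f"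
    using assms(3,4) by (simp add: distrib_right)
qed (use assms(3,4) in simp)

lemma bessel_add:
  assumes "bessel K \<psi>" "bessel K \<delta>"
  shows "bessel K (\<lambda>k. \<psi> k + \<delta> k)"
proof -
  obtain a b where "bessel_bound K \<psi> a" "bessel_bound K \<delta> b"
    using assms by (auto simp: bessel_def)
  then have "bessel_bound K \<psi> ((sqrt a)\<^sup>2)" "0 < sqrt a" "bessel_bound K \<delta> ((sqrt b)\<^sup>2)" "0 < sqrt b"
    by (auto simp: bessel_bound_def)
  from bessel_bound_add[OF this(1,3,2,4)] show ?thesis
    by (auto simp: bessel_def)
qed

lemma bessel_uminus: "bessel K (\<lambda>k. - \<psi> k) \<longleftrightarrow> bessel K \<psi>"
  by (simp add: bessel_def bessel_bound_def cinner_minus_right)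

lemma bessel_diff: "bessel K \<psi> \<Longrightarrow> bessel K \<delta> \<Longrightarrow> bessel K (\<lambda>k. \<psi> k - \<delta> k)"
  using bessel_add[of K \<psi> "\<lambda>k. - \<delta> k"] by (simp add: bessel_uminus)

text \<open>Test the Bessel inequality with \<open>f = \<psi> k\<close> on the single index
  \<open>k\<close>.\<close>

lemma bessel_bound_norm_le:
  assumes "bessel_bound K \<psi> B" "k \<in> K"
  shows "norm (\<psi> k) \<le> sqrt B"
proof -
  have "norm (\<psi> k) * norm (\<psi> k) \<le> sqrt B * norm (\<psi> k)"
    using bessel_bound_L2[OF assms(1), of "{k}" "\<psi> k"] assms(2)
    by (simp add: cinner_self norm_power power2_eq_square norm_mult)
  moreover have "0 \<le> sqrt B" using assms by (simp add: bessel_bound_def)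
  ultimately show ?thesis
    by (cases "\<psi> k = 0") auto
qed

text \<open>Synthesis is adjoint to analysis and has the same norm: pair the combination
  \<open>y\<close> with itself, apply Cauchy--Schwarz over \<open>G\<close>, and cancel one factor
  \<open>norm y\<close>.\<close>

lemma bessel_synthesis:
  assumes \<psi>: "bessel_bound K \<psi> B" and G: "finite G" "G \<subseteq> K"
  shows "norm (\<Sum>k\<in>G. a k *\<^sub>C \<psi> k) \<le> sqrt B * L2_set (\<lambda>k. cmod (a k)) G"
proof -
  define y where "y = (\<Sum>k\<in>G. a k *\<^sub>C \<psi> k)"
  have "complex_of_real ((norm y)\<^sup>2) = (\<Sum>k\<in>G. cnj (a k) * cinner y (\<psi> k))"
    unfolding cinner_self[symmetric] by (subst (2) y_def) (simp add: cinner_sum_right cinner_scaleC_right)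
  then have "(norm y)\<^sup>2 = cmod (\<Sum>k\<in>G. cnj (a k) * cinner y (\<psi> k))"
    by (metis abs_power2 norm_of_real)
  also have "\<dots> \<le> (\<Sum>k\<in>G. \<bar>cmod (a k)\<bar> * \<bar>cmod (cinner y (\<psi> k))\<bar>)"
    by (rule order_trans[OF norm_sum]) (simp add: norm_mult)
  also have "\<dots> \<le> L2_set (\<lambda>k. cmod (a k)) G * L2_set (\<lambda>k. cmod (cinner y (\<psi> k))) G"
    by (rule L2_set_mult_ineq)
  also have "\<dots> \<le> L2_set (\<lambda>k. cmod (a k)) G * (sqrt B * norm y)"
    by (intro mult_left_mono bessel_bound_L2[OF \<psi> G] L2_set_nonneg)
  finally have "norm y * norm y \<le> (sqrt B * L2_set (\<lambda>k. cmod (a k)) G) * norm y"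
    by (simp add: power2_eq_square mult_ac)
  moreover have "0 \<le> sqrt B * L2_set (\<lambda>k. cmod (a k)) G"
    using \<psi> by (auto simp: bessel_bound_def intro!: mult_nonneg_nonneg L2_set_nonneg)
  ultimately have "norm y \<le> sqrt B * L2_set (\<lambda>k. cmod (a k)) G"
    by (cases "y = 0") auto
  then show ?thesis by (simp add: y_def)
qed

text \<open>The family \<open>f\<close> need not be absolutely summable.\<close>

lemma summable_on_if_norm_sq_sum_le:
  fixes f :: "'k \<Rightarrow> 'b::banach" and g :: "'k \<Rightarrow> real"
  assumes g: "g summable_on K"
    and fg: "\<And>G. finite G \<Longrightarrow> G \<subseteq> K \<Longrightarrow> (norm (sum f G))\<^sup>2 \<le> C * sum g G"
  shows "f summable_on K"
proof -
  have "\<exists>P. eventually P (finite_subsets_at_top K) \<and>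
      (\<forall>F F'. P F \<and> P F' \<longrightarrow> dist (sum f F) (sum f F') < e)" if e: "e > 0" for e
  proof -
    \<comment> \<open>Chosen so that \<open>(\<bar>C\<bar> + 1) * d = (e / 2)\<^sup>2\<close>; the
      summand 1 covers \<open>C = 0\<close>.\<close>
    define d where "d = (e / 2)\<^sup>2 / (\<bar>C\<bar> + 1)"
    have d: "0 < d" using e by (simp add: d_def add_nonneg_pos)
    have "((sum g) \<longlongrightarrow> infsum g K) (finite_subsets_at_top K)"
      using has_sum_infsum[OF g] by (simp add: has_sum_def)
    then have "\<forall>\<^sub>F F in finite_subsets_at_top K. dist (sum g F) (infsum g K) < d / 2"
      using d by (intro tendstoD) auto
    then obtain F0 where F0: "finite F0" "F0 \<subseteq> K"
      and near: "\<And>F. finite F \<Longrightarrow> F0 \<subseteq> F \<Longrightarrow> F \<subseteq> K \<Longrightarrow> dist (sum g F) (infsum g K) < d / 2"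
      by (auto simp: eventually_finite_subsets_at_top)
    have close: "dist (sum f F) (sum f F0) < e / 2" if F: "finite F" "F0 \<subseteq> F" "F \<subseteq> K" for F
    proof -
      have g_small: "\<bar>sum g (F - F0)\<bar> < d"
        using dist_triangle_half_l[OF near[OF F] near[OF F0(1) order_refl F0(2)]] F
        by (simp add: sum_diff dist_real_def)
      have "(dist (sum f F) (sum f F0))\<^sup>2 = (norm (sum f (F - F0)))\<^sup>2"
        using F by (simp add: sum_diff dist_norm)
      also have "\<dots> \<le> C * sum g (F - F0)"
        using F by (intro fg) auto
      also have "\<dots> \<le> \<bar>C\<bar> * \<bar>sum g (F - F0)\<bar>"
        by (metis abs_ge_self abs_mult)
      also have "\<dots> \<le> (\<bar>C\<bar> + 1) * \<bar>sum g (F - F0)\<bar>"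
        by (intro mult_right_mono) auto
      also have "\<dots> < (\<bar>C\<bar> + 1) * d"
        using g_small by (intro mult_strict_left_mono) auto
      also have "\<dots> = (e / 2)\<^sup>2"
        by (simp add: d_def add_nonneg_eq_0_iff)
      finally show ?thesis
        by (rule power2_less_imp_less) (use e in auto)
    qed
    show ?thesis
    proof (intro exI[of _ "\<lambda>F. finite F \<and> F0 \<subseteq> F \<and> F \<subseteq> K"] conjI allI impI)
      show "\<forall>\<^sub>F F in finite_subsets_at_top K. finite F \<and> F0 \<subseteq> F \<and> F \<subseteq> K"
        unfolding eventually_finite_subsets_at_top using F0 by blast
      fix F F' assume "(finite F \<and> F0 \<subseteq> F \<and> F \<subseteq> K) \<and> finite F' \<and> F0 \<subseteq> F' \<and> F' \<subseteq> K"
      then show "dist (sum f F) (sum f F') < e"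
        using close[of F] close[of F'] dist_triangle2[of "sum f F" "sum f F'" "sum f F0"] by force
    qed
  qed
  \<comment> \<open>Finite subsets form a net, possibly not a sequence, so completeness is used in
    its filter form.\<close>
  then have "cauchy_filter (filtermap (sum f) (finite_subsets_at_top K))"
    by (simp add: cauchy_filter_metric_filtermap)
  moreover have "complete (UNIV :: 'b set)"
    by (meson Cauchy_convergent UNIV_I complete_def convergent_def)
  ultimately obtain L where "(sum f \<longlongrightarrow> L) (finite_subsets_at_top K)"
    using complete_uniform[where S = UNIV] by (force simp: filterlim_def)
  then show ?thesis
    by (auto simp: summable_on_def has_sum_def)
qed

section \<open>Multipliers\<close>

lemma L2_set_mult_le:
  assumes "\<And>k. k \<in> G \<Longrightarrow> cmod (c k) \<le> s" "0 \<le> s"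
  shows "L2_set (\<lambda>k. cmod (c k * x k)) G \<le> s * L2_set (\<lambda>k. cmod (x k)) G"
  unfolding L2_set_right_distrib[OF assms(2)]
  by (intro L2_set_mono) (auto simp: norm_mult intro: mult_right_mono assms)

text \<open>The synthesis estimate bounds every finite partial sum by the matching partial sum of
  the convergent series of squared analysis coefficients.\<close>

lemma multiplier_summable:
  fixes \<psi> :: "'k \<Rightarrow> 'b::chilbert_space"
  assumes "bessel K \<psi>" "bessel K \<phi>" and c: "\<forall>k\<in>K. cmod (c k) \<le> s"
  shows "(\<lambda>k. (c k * cinner f (\<phi> k)) *\<^sub>C \<psi> k) summable_on K"
proof -
  obtain B B' where \<psi>: "bessel_bound K \<psi> B" and \<phi>: "bessel_bound K \<phi> B'"
    using assms by (auto simp: bessel_def)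
  show ?thesis
  proof (rule summable_on_if_norm_sq_sum_le)
    show "(\<lambda>k. (cmod (cinner f (\<phi> k)))\<^sup>2) summable_on K"
      using \<phi> by (simp add: bessel_bound_def)
    fix G assume G: "finite G" "G \<subseteq> K"
    let ?x = "\<lambda>k. cinner f (\<phi> k)"
    have "norm (\<Sum>k\<in>G. (c k * ?x k) *\<^sub>C \<psi> k) \<le> sqrt B * L2_set (\<lambda>k. cmod (c k * ?x k)) G"
      by (rule bessel_synthesis[OF \<psi> G])
    \<comment> \<open>For empty \<open>K\<close> the bound \<open>c\<close> leaves the sign of
      \<open>s\<close> open, hence the absolute value.\<close>
    also have "\<dots> \<le> sqrt B * (\<bar>s\<bar> * L2_set (\<lambda>k. cmod (?x k)) G)"
      using \<psi> G c by (intro mult_left_mono L2_set_mult_le) (force simp: bessel_bound_def)+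
    finally have "(norm (\<Sum>k\<in>G. (c k * ?x k) *\<^sub>C \<psi> k))\<^sup>2
        \<le> (sqrt B * (\<bar>s\<bar> * L2_set (\<lambda>k. cmod (?x k)) G))\<^sup>2"
      by (intro power_mono) auto
    also have "\<dots> = (B * s\<^sup>2) * (\<Sum>k\<in>G. (cmod (?x k))\<^sup>2)"
      using \<psi> by (simp add: power_mult_distrib L2_set_def bessel_bound_def sum_nonneg)
    finally show "(norm (\<Sum>k\<in>G. (c k * ?x k) *\<^sub>C \<psi> k))\<^sup>2 \<le> (B * s\<^sup>2) * (\<Sum>k\<in>G. (cmod (?x k))\<^sup>2)" .
  qed
qed

lemma multiplier_tendsto:
  fixes \<psi> :: "'k \<Rightarrow> 'b::chilbert_space"
  assumes "bessel K \<psi>" "bessel K \<phi>" "\<forall>k\<in>K. cmod (c k) \<le> s"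
  shows "((\<lambda>G. \<Sum>k\<in>G. (c k * cinner f (\<phi> k)) *\<^sub>C \<psi> k) \<longlongrightarrow> multiplier K c \<psi> \<phi> f)
    (finite_subsets_at_top K)"
  using has_sum_infsum[OF multiplier_summable[OF assms]] by (simp add: has_sum_def multiplier_def)

lemma le_if_finite_sums_le:
  fixes g :: "'k set \<Rightarrow> real"
  assumes "(g \<longlongrightarrow> L) (finite_subsets_at_top K)"
    and "\<And>G. finite G \<Longrightarrow> G \<subseteq> K \<Longrightarrow> g G \<le> M"
  shows "L \<le> M"
  using assms by (intro tendsto_upperbound[OF assms(1)] eventually_finite_subsets_at_top_weakI) auto

text \<open>A multiplier is analysis by \<open>\<phi>\<close>, then multiplication by
  \<open>c\<close>, then synthesis by \<open>\<psi>\<close>; the three factors of the bound are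
  bounds for the norms of these steps.\<close>

lemma op_bound_multiplier:
  fixes \<psi> :: "'k \<Rightarrow> 'b::chilbert_space"
  assumes \<psi>: "bessel_bound K \<psi> B" and \<phi>: "bessel_bound K \<phi> B'"
    and c: "\<forall>k\<in>K. cmod (c k) \<le> s" and s: "0 \<le> s"
  shows "op_bound (multiplier K c \<psi> \<phi>) (s * sqrt B * sqrt B')"
proof -
  let ?T = "multiplier K c \<psi> \<phi>"
  have bes: "bessel K \<psi>" "bessel K \<phi>" using \<psi> \<phi> by (auto simp: bessel_def)
  note summ = multiplier_summable[OF bes c] and tends = multiplier_tendsto[OF bes c]
  have le: "norm (?T f) \<le> (s * sqrt B * sqrt B') * norm f" for f
  proof (rule le_if_finite_sums_le[OF tendsto_norm[OF tends]])
    fix G assume G: "finite G" "G \<subseteq> K"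
    let ?x = "\<lambda>k. cinner f (\<phi> k)"
    have "norm (\<Sum>k\<in>G. (c k * ?x k) *\<^sub>C \<psi> k) \<le> sqrt B * L2_set (\<lambda>k. cmod (c k * ?x k)) G"
      by (rule bessel_synthesis[OF \<psi> G])
    also have "\<dots> \<le> sqrt B * (s * L2_set (\<lambda>k. cmod (?x k)) G)"
      using \<psi> G c s by (intro mult_left_mono L2_set_mult_le) (auto simp: bessel_bound_def)
    also have "\<dots> \<le> sqrt B * (s * (sqrt B' * norm f))"
      using \<psi> s by (intro mult_left_mono bessel_bound_L2[OF \<phi> G]) (auto simp: bessel_bound_def)
    finally show "norm (\<Sum>k\<in>G. (c k * ?x k) *\<^sub>C \<psi> k) \<le> (s * sqrt B * sqrt B') * norm f"
      by (simp add: mult_ac)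
  qed
  have "bounded_clinear ?T"
  proof (rule bounded_clinear_intro[OF _ _ le])
    show "?T (x + y) = ?T x + ?T y" for x y
      unfolding multiplier_def using infsum_add[OF summ summ]
      by (simp add: cinner_add_left distrib_left scaleC_add_left)
    show "?T (d *\<^sub>C x) = d *\<^sub>C ?T x" for d x
      unfolding multiplier_def
      using infsumI[OF has_sum_bounded_linear[OF bounded_linear_scaleC_right[of d]
            has_sum_infsum[OF summ[of x]]]]
      by (simp add: cinner_scaleC_left scaleC_scaleC mult_ac)
  qed
  then show ?thesis
    using le s \<psi> \<phi> by (auto simp: op_bound_def bessel_bound_def)
qed

text \<open>Summing over the basis first collapses the coefficients of each \<open>\<phi> k\<close>
  to at most \<open>(norm (\<phi> k))\<^sup>2\<close>, hence to \<open>B'\<close>, and leaves the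
  squared sum of the symbol.\<close>

lemma hs_bound_multiplier:
  fixes \<psi> :: "'k \<Rightarrow> 'b::chilbert_space" and \<phi> :: "'k \<Rightarrow> 'a::chilbert_space"
  assumes \<psi>: "bessel_bound K \<psi> B" and \<phi>: "bessel_bound K \<phi> B'"
    and c: "\<And>G. finite G \<Longrightarrow> G \<subseteq> K \<Longrightarrow> L2_set (\<lambda>k. cmod (c k)) G \<le> s"
  shows "hs_bound (multiplier K c \<psi> \<phi>) (s * sqrt B * sqrt B')"
proof -
  let ?T = "multiplier K c \<psi> \<phi>"
  have bes: "bessel K \<psi>" "bessel K \<phi>" using \<psi> \<phi> by (auto simp: bessel_def)
  have c': "\<forall>k\<in>K. cmod (c k) \<le> s"
  proof
    fix k assume "k \<in> K"
    then show "cmod (c k) \<le> s" using c[of "{k}"] by simp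
  qed
  have s: "0 \<le> s" using c[of "{}"] by simp
  have B: "0 < B" "0 < B'" using \<psi> \<phi> by (auto simp: bessel_bound_def)
  note tends = multiplier_tendsto[OF bes c']
  have "L2_set (\<lambda>e. norm (?T e)) F \<le> s * sqrt B * sqrt B'" if F: "finite F" "F \<subseteq> some_onb" for F
  proof (rule le_if_finite_sums_le)
    show "((\<lambda>G. L2_set (\<lambda>e. norm (\<Sum>k\<in>G. (c k * cinner e (\<phi> k)) *\<^sub>C \<psi> k)) F) \<longlongrightarrow>
        L2_set (\<lambda>e. norm (?T e)) F) (finite_subsets_at_top K)"
      unfolding L2_set_def by (intro tendsto_real_sqrt tendsto_sum tendsto_power tendsto_norm tends)
    fix G assume G: "finite G" "G \<subseteq> K"
    have col: "(\<Sum>e\<in>F. (cmod (cinner e (\<phi> k)))\<^sup>2) \<le> B'" if "k \<in> G" for k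
    proof -
      have "L2_set (\<lambda>e. cmod (cinner (\<phi> k) e)) F \<le> norm (\<phi> k)"
        by (rule contractive_bessel[OF contractive_orthonormal[OF orthonormal_some_onb F]])
      also have "\<dots> \<le> sqrt B'"
        using that G by (intro bessel_bound_norm_le[OF \<phi>]) auto
      finally have "(\<Sum>e\<in>F. (cmod (cinner (\<phi> k) e))\<^sup>2) \<le> B'"
        by (simp add: L2_set_def)
      moreover have "cmod (cinner e (\<phi> k)) = cmod (cinner (\<phi> k) e)" for e
        by (subst cinner_commute) simp
      ultimately show ?thesis by simp
    qed
    have "(\<Sum>e\<in>F. (norm (\<Sum>k\<in>G. (c k * cinner e (\<phi> k)) *\<^sub>C \<psi> k))\<^sup>2)
        \<le> (\<Sum>e\<in>F. (sqrt B * L2_set (\<lambda>k. cmod (c k * cinner e (\<phi> k))) G)\<^sup>2)"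
      by (intro sum_mono power_mono bessel_synthesis[OF \<psi> G]) auto
    also have "\<dots> = B * (\<Sum>e\<in>F. \<Sum>k\<in>G. (cmod (c k))\<^sup>2 * (cmod (cinner e (\<phi> k)))\<^sup>2)"
      using B by (simp add: L2_set_def power_mult_distrib sum_nonneg norm_mult sum_distrib_left)
    also have "\<dots> = B * (\<Sum>k\<in>G. (cmod (c k))\<^sup>2 * (\<Sum>e\<in>F. (cmod (cinner e (\<phi> k)))\<^sup>2))"
      by (subst sum.swap) (simp add: sum_distrib_left)
    also have "\<dots> \<le> B * (\<Sum>k\<in>G. (cmod (c k))\<^sup>2 * B')"
      using B by (intro mult_left_mono sum_mono col) auto
    also have "\<dots> = B * B' * (L2_set (\<lambda>k. cmod (c k)) G)\<^sup>2"
      by (simp add: L2_set_def sum_nonneg mult_ac flip: sum_distrib_left)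
    also have "\<dots> \<le> B * B' * s\<^sup>2"
      using B by (intro mult_left_mono power_mono c G L2_set_nonneg) auto
    also have "\<dots> = (s * sqrt B * sqrt B')\<^sup>2"
      using B by (simp add: power_mult_distrib)
    finally show "L2_set (\<lambda>e. norm (\<Sum>k\<in>G. (c k * cinner e (\<phi> k)) *\<^sub>C \<psi> k)) F \<le> s * sqrt B * sqrt B'"
      unfolding L2_set_def using B s by (intro real_le_lsqrt) auto
  qed
  then show ?thesis
    using op_bound_multiplier[OF \<psi> \<phi> c' s] by (simp add: hs_bound_def op_bound_def)
qed

text \<open>The Bessel property ensures that the series converges, while the size is measured by the
  suprema \<open>p\<close> and \<open>q\<close>: uniform closeness makes the supremum of a
  difference small but not its Bessel bound.\<close>

lemma nuclear_bound_multiplier: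
  fixes \<psi> :: "'k \<Rightarrow> 'b::chilbert_space" and \<phi> :: "'k \<Rightarrow> 'a::chilbert_space"
  assumes bes: "bessel K \<psi>" "bessel K \<phi>"
    and \<psi>: "\<And>k. k \<in> K \<Longrightarrow> norm (\<psi> k) \<le> p" and \<phi>: "\<And>k. k \<in> K \<Longrightarrow> norm (\<phi> k) \<le> q"
    and pq: "0 \<le> p" "0 \<le> q"
    and c: "\<And>G. finite G \<Longrightarrow> G \<subseteq> K \<Longrightarrow> (\<Sum>k\<in>G. cmod (c k)) \<le> s"
  shows "nuclear_bound (multiplier K c \<psi> \<phi>) (s * p * q)"
proof -
  let ?T = "multiplier K c \<psi> \<phi>"
  have c': "\<forall>k\<in>K. cmod (c k) \<le> s"
  proof
    fix k assume "k \<in> K"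
    then show "cmod (c k) \<le> s" using c[of "{k}"] by simp
  qed
  have s: "0 \<le> s" using c[of "{}"] by simp
  note tends = multiplier_tendsto[OF bes c']
  have "cmod (\<Sum>e\<in>F. cinner (?T e) (u e)) \<le> s * p * q"
    if F: "finite F" "F \<subseteq> some_onb" and u: "contractive F u" for F and u :: "'a \<Rightarrow> 'b"
  proof (rule le_if_finite_sums_le)
    show "((\<lambda>G. cmod (\<Sum>e\<in>F. cinner (\<Sum>k\<in>G. (c k * cinner e (\<phi> k)) *\<^sub>C \<psi> k) (u e))) \<longlongrightarrow>
        cmod (\<Sum>e\<in>F. cinner (?T e) (u e))) (finite_subsets_at_top K)"
      by (intro tendsto_norm tendsto_sum tendsto_cinner_left tends)
    fix G assume G: "finite G" "G \<subseteq> K"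
    have one: "cmod (\<Sum>e\<in>F. cinner e (\<phi> k) * cinner (\<psi> k) (u e)) \<le> p * q" if "k \<in> K" for k
    proof -
      have "cmod (\<Sum>e\<in>F. cinner e (\<phi> k) * cinner (\<psi> k) (u e))
          \<le> (\<Sum>e\<in>F. \<bar>cmod (cinner (\<psi> k) (u e))\<bar> * \<bar>cmod (cinner (\<phi> k) e)\<bar>)"
      proof (rule order_trans[OF norm_sum sum_mono])
        show "cmod (cinner e (\<phi> k) * cinner (\<psi> k) (u e))
            \<le> \<bar>cmod (cinner (\<psi> k) (u e))\<bar> * \<bar>cmod (cinner (\<phi> k) e)\<bar>" for e
          by (subst cinner_commute[of e]) (simp add: norm_mult)
      qed
      also have "\<dots> \<le> L2_set (\<lambda>e. cmod (cinner (\<psi> k) (u e))) F * L2_set (\<lambda>e. cmod (cinner (\<phi> k) e)) F"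
        by (rule L2_set_mult_ineq)
      also have "\<dots> \<le> norm (\<psi> k) * norm (\<phi> k)"
        by (intro mult_mono contractive_bessel u L2_set_nonneg norm_ge_zero
            contractive_orthonormal[OF orthonormal_some_onb F])
      also have "\<dots> \<le> p * q"
        using that pq by (intro mult_mono \<psi> \<phi>) auto
      finally show ?thesis .
    qed
    have "(\<Sum>e\<in>F. cinner (\<Sum>k\<in>G. (c k * cinner e (\<phi> k)) *\<^sub>C \<psi> k) (u e))
        = (\<Sum>k\<in>G. c k * (\<Sum>e\<in>F. cinner e (\<phi> k) * cinner (\<psi> k) (u e)))"
      unfolding cinner_sum_left cinner_scaleC_left sum_distrib_left
      by (subst sum.swap) (simp add: mult_ac)
    then have "cmod (\<Sum>e\<in>F. cinner (\<Sum>k\<in>G. (c k * cinner e (\<phi> k)) *\<^sub>C \<psi> k) (u e))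
        \<le> (\<Sum>k\<in>G. cmod (c k * (\<Sum>e\<in>F. cinner e (\<phi> k) * cinner (\<psi> k) (u e))))"
      by (simp add: norm_sum)
    also have "\<dots> \<le> (\<Sum>k\<in>G. cmod (c k) * (p * q))"
      unfolding norm_mult[of "c _"] using G by (intro sum_mono mult_left_mono one) auto
    also have "\<dots> \<le> s * (p * q)"
      unfolding sum_distrib_right[symmetric] using pq by (intro mult_right_mono c G) auto
    finally show "cmod (\<Sum>e\<in>F. cinner (\<Sum>k\<in>G. (c k * cinner e (\<phi> k)) *\<^sub>C \<psi> k) (u e)) \<le> s * p * q"
      by (simp add: mult.assoc)
  qed
  moreover have "bounded_clinear ?T"
    using op_bound_multiplier[of K \<psi> _ \<phi> _ c s] bes c' s by (auto simp: bessel_def op_bound_def)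
  ultimately show ?thesis
    by (simp add: nuclear_bound_def)
qed

lemma multiplier_diff:
  fixes \<psi> \<psi>' :: "'k \<Rightarrow> 'b::chilbert_space" and \<phi> \<phi>' :: "'k \<Rightarrow> 'a::chilbert_space"
  assumes bes: "bessel K \<psi>" "bessel K \<psi>'" "bessel K \<phi>" "bessel K \<phi>'"
    and c: "\<forall>k\<in>K. cmod (c k) \<le> s" and d: "\<forall>k\<in>K. cmod (c' k - c k) \<le> s'"
  shows "multiplier K c' \<psi>' \<phi>' f - multiplier K c \<psi> \<phi> f =
    multiplier K (\<lambda>k. c' k - c k) \<psi>' \<phi>' f
    + multiplier K c (\<lambda>k. \<psi>' k - \<psi> k) \<phi>' f + multiplier K c \<psi> (\<lambda>k. \<phi>' k - \<phi> k) f"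
proof -
  note bes' = bessel_diff[OF bes(2,1)] bessel_diff[OF bes(4,3)]
  note s1 = multiplier_summable[OF bes(2,4) d, where f = f]
  note s2 = multiplier_summable[OF bes'(1) bes(4) c, where f = f]
  note s3 = multiplier_summable[OF bes(1) bes'(2) c, where f = f]
  note s4 = multiplier_summable[OF bes(1) bes(3) c, where f = f]
  \<comment> \<open>The subtracted multiplier is carried along as a fourth family, so a termwise
    identity and additivity of convergent sums suffice.\<close>
  have "multiplier K c' \<psi>' \<phi>' f = (\<Sum>\<^sub>\<infinity>k\<in>K. ((c' k - c k) * cinner f (\<phi>' k)) *\<^sub>C \<psi>' k
      + (c k * cinner f (\<phi>' k)) *\<^sub>C (\<psi>' k - \<psi> k) + (c k * cinner f (\<phi>' k - \<phi> k)) *\<^sub>C \<psi> k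
      + (c k * cinner f (\<phi> k)) *\<^sub>C \<psi> k)"
    unfolding multiplier_def
    by (rule infsum_cong) (simp add: scaleC_diff_right scaleC_diff_left cinner_diff_right algebra_simps)
  also have "\<dots> = multiplier K (\<lambda>k. c' k - c k) \<psi>' \<phi>' f + multiplier K c (\<lambda>k. \<psi>' k - \<psi> k) \<phi>' f
      + multiplier K c \<psi> (\<lambda>k. \<phi>' k - \<phi> k) f + multiplier K c \<psi> \<phi> f"
    unfolding multiplier_def
    using s1 s2 s3 s4 by (simp add: infsum_add summable_on_add)
  finally show ?thesis by simp
qed

section \<open>Convergence\<close>

text \<open>The predicates \<open>symb\<close>, \<open>Q1\<close>, \<open>Q2\<close> and \<open>bnd\<close> stand for bounds on the symbol, on the two
  sequences and on the multiplier; they are instantiated once for each of the three norms.\<close>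

lemma multiplier_perturbation:
  fixes \<psi> :: "'k \<Rightarrow> 'b::chilbert_space" and \<phi> :: "'k \<Rightarrow> 'a::chilbert_space"
    and Q1 :: "('k \<Rightarrow> 'b) \<Rightarrow> real \<Rightarrow> bool" and Q2 :: "('k \<Rightarrow> 'a) \<Rightarrow> real \<Rightarrow> bool"
    and bnd :: "('a \<Rightarrow> 'b) \<Rightarrow> real \<Rightarrow> bool"
  assumes symb_le: "\<And>c s k. symb c s \<Longrightarrow> k \<in> K \<Longrightarrow> cmod (c k) \<le> s"
    and bessel1: "\<And>\<psi> a. Q1 \<psi> a \<Longrightarrow> bessel K \<psi>" and bessel2: "\<And>\<phi> a. Q2 \<phi> a \<Longrightarrow> bessel K \<phi>"
    and add1: "\<And>\<psi> \<delta> a b. Q1 \<psi> a \<Longrightarrow> Q1 \<delta> b \<Longrightarrow> Q1 (\<lambda>k. \<psi> k + \<delta> k) (a + b)"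
    and add2: "\<And>\<phi> \<delta> a b. Q2 \<phi> a \<Longrightarrow> Q2 \<delta> b \<Longrightarrow> Q2 (\<lambda>k. \<phi> k + \<delta> k) (a + b)"
    and mult: "\<And>c \<psi> \<phi> s a b. symb c s \<Longrightarrow> Q1 \<psi> a \<Longrightarrow> Q2 \<phi> b \<Longrightarrow> bnd (multiplier K c \<psi> \<phi>) (s * a * b)"
    and bnd_add: "\<And>S T a b. bnd S a \<Longrightarrow> bnd T b \<Longrightarrow> bnd (\<lambda>f. S f + T f) (a + b)"
    and bnd_converges: "\<And>S T h. (h \<longlongrightarrow> 0) (at_right 0) \<Longrightarrow>
      (\<And>\<eta>::real. 0 < \<eta> \<Longrightarrow> \<forall>\<^sub>F l in sequentially. bnd (\<lambda>f. S l f - T f) (h \<eta>)) \<Longrightarrow> conv S T"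
    and m: "symb m s" and \<psi>: "Q1 \<psi> a" and \<phi>: "Q2 \<phi> b"
    and m': "\<And>\<eta>. 0 < \<eta> \<Longrightarrow> \<forall>\<^sub>F l in sequentially. symb (\<lambda>k. m' l k - m k) \<eta>"
    and \<psi>': "\<And>\<eta>. 0 < \<eta> \<Longrightarrow> \<forall>\<^sub>F l in sequentially. Q1 (\<lambda>k. \<psi>' l k - \<psi> k) \<eta>"
    and \<phi>': "\<And>\<eta>. 0 < \<eta> \<Longrightarrow> \<forall>\<^sub>F l in sequentially. Q2 (\<lambda>k. \<phi>' l k - \<phi> k) \<eta>"
  shows "(\<forall>\<^sub>F l in sequentially. bessel K (\<psi>' l) \<and> bessel K (\<phi>' l)) \<and>
    conv (\<lambda>l. multiplier K (m' l) (\<psi>' l) (\<phi>' l)) (multiplier K m \<psi> \<phi>)"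
proof
  \<comment> \<open>The perturbed sequence is the original plus a small one, so it inherits a size
    and, through \<open>bessel1\<close>, the Bessel property.\<close>
  have Q1': "Q1 (\<psi>' l) (a + \<eta>)" if "Q1 (\<lambda>k. \<psi>' l k - \<psi> k) \<eta>" for l \<eta>
    using add1[OF \<psi> that] by simp
  have Q2': "Q2 (\<phi>' l) (b + \<eta>)" if "Q2 (\<lambda>k. \<phi>' l k - \<phi> k) \<eta>" for l \<eta>
    using add2[OF \<phi> that] by simp
  show "\<forall>\<^sub>F l in sequentially. bessel K (\<psi>' l) \<and> bessel K (\<phi>' l)"
    using \<psi>'[OF zero_less_one] \<phi>'[OF zero_less_one]
    by eventually_elim (use Q1' Q2' bessel1 bessel2 in blast)
  \<comment> \<open>One summand for each term of \<open>multiplier_diff\<close>: perturbed sequences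
    have sizes \<open>a + \<eta>\<close> and \<open>b + \<eta>\<close>, and the differing entry has
    size \<open>\<eta>\<close>.\<close>
  let ?h = "\<lambda>\<eta>. \<eta> * (a + \<eta>) * (b + \<eta>) + s * \<eta> * (b + \<eta>) + s * a * \<eta>"
  show "conv (\<lambda>l. multiplier K (m' l) (\<psi>' l) (\<phi>' l)) (multiplier K m \<psi> \<phi>)"
  proof (rule bnd_converges)
    show "(?h \<longlongrightarrow> 0) (at_right 0)"
      by (auto intro!: tendsto_eq_intros)
    fix \<eta> :: real assume "0 < \<eta>"
    from m'[OF this] \<psi>'[OF this] \<phi>'[OF this]
    show "\<forall>\<^sub>F l in sequentially.
        bnd (\<lambda>f. multiplier K (m' l) (\<psi>' l) (\<phi>' l) f - multiplier K m \<psi> \<phi> f) (?h \<eta>)"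
    proof eventually_elim
      case (elim l)
      have "multiplier K (m' l) (\<psi>' l) (\<phi>' l) f - multiplier K m \<psi> \<phi> f =
          multiplier K (\<lambda>k. m' l k - m k) (\<psi>' l) (\<phi>' l) f
          + multiplier K m (\<lambda>k. \<psi>' l k - \<psi> k) (\<phi>' l) f
          + multiplier K m \<psi> (\<lambda>k. \<phi>' l k - \<phi> k) f" for f
        by (rule multiplier_diff)
           (use symb_le[OF m] symb_le[OF elim(1)] bessel1[OF \<psi>] bessel2[OF \<phi>] bessel1[OF Q1'[OF elim(2)]]
             bessel2[OF Q2'[OF elim(3)]] in auto)
      then show ?case
        using bnd_add[OF bnd_add[OF mult[OF elim(1) Q1'[OF elim(2)] Q2'[OF elim(3)]]
              mult[OF m elim(2) Q2'[OF elim(3)]]] mult[OF m \<psi> elim(3)]]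
        by simp
    qed
  qed
qed

section \<open>From norms of families to bounds on entries and finite sums\<close>

lemma in_linf_diff:
  assumes "in_linf K x" "in_linf K y"
  shows "in_linf K (\<lambda>k. x k - y k)"
proof -
  obtain a b where "\<And>k. k \<in> K \<Longrightarrow> norm (x k) \<le> a" "\<And>k. k \<in> K \<Longrightarrow> norm (y k) \<le> b"
    using assms by (auto simp: in_linf_def bounded_iff)
  then have "norm (x k - y k) \<le> a + b" if "k \<in> K" for k
    using that norm_triangle_ineq4[of "x k" "y k"] by (meson add_mono order_trans)
  then show ?thesis
    by (auto simp: in_linf_def bounded_iff)
qed

text \<open>The real \<open>Sup\<close> is unspecified on unbounded sets, so a value of
  \<open>linf_norm\<close> is informative only together with \<open>in_linf\<close>; for differences
  \<open>in_linf_diff\<close> provides it.\<close>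

lemma norm_le_linf_norm:
  assumes "in_linf K x" "k \<in> K"
  shows "norm (x k) \<le> linf_norm K x"
proof -
  obtain a where "\<And>k. k \<in> K \<Longrightarrow> norm (x k) \<le> a"
    using assms by (auto simp: in_linf_def bounded_iff)
  then have "bdd_above (insert 0 ((\<lambda>k. norm (x k)) ` K))"
    by (auto intro!: bdd_aboveI[where M = a])
  then show ?thesis
    unfolding linf_norm_def using assms(2) by (intro cSup_upper) auto
qed

text \<open>A divergent \<open>infsum\<close> is 0 by default, so a small \<open>lp_norm\<close> of
  a difference means something only once membership is known. Bounding by twice the maximum gives
  this directly for every exponent.\<close>

lemma in_lp_diff:
  assumes "in_lp p K x" "in_lp p K y" "0 \<le> p"
  shows "in_lp p K (\<lambda>k. x k - y k)"
  unfolding in_lp_def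
proof (rule summable_on_comparison_test)
  show "(\<lambda>k. 2 powr p * (norm (x k) powr p + norm (y k) powr p)) summable_on K"
    using assms unfolding in_lp_def by (intro summable_on_cmult_right summable_on_add)
  fix k
  have "norm (x k - y k) \<le> 2 * max (norm (x k)) (norm (y k))"
    using norm_triangle_ineq4[of "x k" "y k"] by linarith
  then have "norm (x k - y k) powr p \<le> (2 * max (norm (x k)) (norm (y k))) powr p"
    by (rule powr_mono2[OF assms(3) norm_ge_zero])
  also have "\<dots> = 2 powr p * max (norm (x k)) (norm (y k)) powr p"
    by (rule powr_mult)
  also have "\<dots> \<le> 2 powr p * (norm (x k) powr p + norm (y k) powr p)"
    by (intro mult_left_mono) (auto simp: max_def)
  finally show "norm (x k - y k) powr p \<le> 2 powr p * (norm (x k) powr p + norm (y k) powr p)" .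
qed auto

lemma finite_sum_le_lp_norm:
  assumes "in_lp p K x" "finite G" "G \<subseteq> K" "0 \<le> p"
  shows "(\<Sum>k\<in>G. norm (x k) powr p) powr (1 / p) \<le> lp_norm p K x"
  unfolding lp_norm_def
  by (intro powr_mono2 sum_nonneg finite_sum_le_infsum) (use assms in \<open>auto simp: in_lp_def\<close>)

lemma sum_norm_le_l1_norm:
  assumes "in_lp 1 K x" "finite G" "G \<subseteq> K"
  shows "(\<Sum>k\<in>G. norm (x k)) \<le> lp_norm 1 K x"
  using finite_sum_le_lp_norm[OF assms] by (simp add: sum_nonneg)

lemma L2_set_le_l2_norm:
  assumes "in_lp 2 K x" "finite G" "G \<subseteq> K"
  shows "L2_set (\<lambda>k. norm (x k)) G \<le> lp_norm 2 K x"
  using finite_sum_le_lp_norm[OF assms]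
  by (simp add: L2_set_def powr_half_sqrt sum_nonneg)

lemma symbols_converge_linfD:
  assumes "symbols_converge_linf K m' m"
  shows "\<exists>s\<ge>0. \<forall>k\<in>K. cmod (m k) \<le> s"
    and "0 < \<eta> \<Longrightarrow> \<forall>\<^sub>F l in sequentially. \<forall>k\<in>K. cmod (m' l k - m k) \<le> \<eta>"
proof -
  have m: "in_linf K m" "\<And>l. in_linf K (m' l)"
    and lim: "(\<lambda>l. linf_norm K (\<lambda>k. m' l k - m k)) \<longlonglongrightarrow> 0"
    using assms by (auto simp: symbols_converge_linf_def)
  have "\<forall>k\<in>K. cmod (m k) \<le> \<bar>linf_norm K m\<bar>"
    using norm_le_linf_norm[OF m(1)] by force
  then show "\<exists>s\<ge>0. \<forall>k\<in>K. cmod (m k) \<le> s"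
    using abs_ge_zero by blast
  have le: "cmod (m' l k - m k) \<le> linf_norm K (\<lambda>k. m' l k - m k)" if "k \<in> K" for l k
    using norm_le_linf_norm[OF in_linf_diff[OF m(2) m(1)] that] .
  show "\<forall>\<^sub>F l in sequentially. \<forall>k\<in>K. cmod (m' l k - m k) \<le> \<eta>" if "0 < \<eta>"
    using order_tendstoD(2)[OF lim that]
    by eventually_elim (auto intro: order_trans[OF le] less_imp_le)
qed

lemma symbols_converge_l1D:
  assumes "symbols_converge_lp 1 K m' m"
  shows "\<exists>s. \<forall>G. finite G \<longrightarrow> G \<subseteq> K \<longrightarrow> (\<Sum>k\<in>G. cmod (m k)) \<le> s"
    and "0 < \<eta> \<Longrightarrow> \<forall>\<^sub>F l in sequentially. \<forall>G. finite G \<longrightarrow> G \<subseteq> K \<longrightarrow> (\<Sum>k\<in>G. cmod (m' l k - m k)) \<le> \<eta>"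
proof -
  have m: "in_lp 1 K m" "\<And>l. in_lp 1 K (m' l)"
    and lim: "(\<lambda>l. lp_norm 1 K (\<lambda>k. m' l k - m k)) \<longlonglongrightarrow> 0"
    using assms by (auto simp: symbols_converge_lp_def)
  show "\<exists>s. \<forall>G. finite G \<longrightarrow> G \<subseteq> K \<longrightarrow> (\<Sum>k\<in>G. cmod (m k)) \<le> s"
    using sum_norm_le_l1_norm[OF m(1)] by blast
  have le: "(\<Sum>k\<in>G. cmod (m' l k - m k)) \<le> lp_norm 1 K (\<lambda>k. m' l k - m k)" if "finite G" "G \<subseteq> K" for l G
    using sum_norm_le_l1_norm[OF in_lp_diff[OF m(2) m(1)] that] by simp
  show "\<forall>\<^sub>F l in sequentially. \<forall>G. finite G \<longrightarrow> G \<subseteq> K \<longrightarrow> (\<Sum>k\<in>G. cmod (m' l k - m k)) \<le> \<eta>" if "0 < \<eta>"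
    using order_tendstoD(2)[OF lim that]
    by eventually_elim (auto intro: order_trans[OF le] less_imp_le)
qed

lemma symbols_converge_l2D:
  assumes "symbols_converge_lp 2 K m' m"
  shows "\<exists>s. \<forall>G. finite G \<longrightarrow> G \<subseteq> K \<longrightarrow> L2_set (\<lambda>k. cmod (m k)) G \<le> s"
    and "0 < \<eta> \<Longrightarrow> \<forall>\<^sub>F l in sequentially. \<forall>G. finite G \<longrightarrow> G \<subseteq> K \<longrightarrow> L2_set (\<lambda>k. cmod (m' l k - m k)) G \<le> \<eta>"
proof -
  have m: "in_lp 2 K m" "\<And>l. in_lp 2 K (m' l)"
    and lim: "(\<lambda>l. lp_norm 2 K (\<lambda>k. m' l k - m k)) \<longlonglongrightarrow> 0"
    using assms by (auto simp: symbols_converge_lp_def)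
  show "\<exists>s. \<forall>G. finite G \<longrightarrow> G \<subseteq> K \<longrightarrow> L2_set (\<lambda>k. cmod (m k)) G \<le> s"
    using L2_set_le_l2_norm[OF m(1)] by blast
  have le: "L2_set (\<lambda>k. cmod (m' l k - m k)) G \<le> lp_norm 2 K (\<lambda>k. m' l k - m k)" if "finite G" "G \<subseteq> K" for l G
    using L2_set_le_l2_norm[OF in_lp_diff[OF m(2) m(1)] that] by simp
  show "\<forall>\<^sub>F l in sequentially. \<forall>G. finite G \<longrightarrow> G \<subseteq> K \<longrightarrow> L2_set (\<lambda>k. cmod (m' l k - m k)) G \<le> \<eta>" if "0 < \<eta>"
    using order_tendstoD(2)[OF lim that]
    by eventually_elim (auto intro: order_trans[OF le] less_imp_le)
qed

text \<open>Apply Cauchy--Schwarz to each coefficient and pull out \<open>norm f\<close>.\<close>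

lemma bessel_bound_if_L2_le:
  assumes "\<And>G. finite G \<Longrightarrow> G \<subseteq> K \<Longrightarrow> L2_set (\<lambda>k. norm (\<delta> k)) G \<le> \<eta>" "0 < \<eta>"
  shows "bessel_bound K \<delta> (\<eta>\<^sup>2)"
  unfolding bessel_bound_iff
proof (intro conjI allI impI)
  fix f :: 'b and G assume G: "finite G" "G \<subseteq> K"
  have "L2_set (\<lambda>k. cmod (cinner f (\<delta> k))) G \<le> L2_set (\<lambda>k. norm f * norm (\<delta> k)) G"
    by (intro L2_set_mono norm_cinner_le norm_ge_zero)
  also have "\<dots> = norm f * L2_set (\<lambda>k. norm (\<delta> k)) G"
    by (simp add: L2_set_right_distrib)
  also have "\<dots> \<le> norm f * \<eta>"
    by (intro mult_left_mono assms(1) G norm_ge_zero)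
  finally show "L2_set (\<lambda>k. cmod (cinner f (\<delta> k))) G \<le> sqrt (\<eta>\<^sup>2) * norm f"
    using assms(2) by (simp add: mult.commute)
qed (use assms in simp)

lemma seqs_converge_lpD:
  assumes "seqs_converge_lp p K \<psi>' \<psi>" "p = 1 \<or> p = 2" "0 < \<eta>"
  shows "\<forall>\<^sub>F l in sequentially. bessel_bound K (\<lambda>k. \<psi>' l k - \<psi> k) (\<eta>\<^sup>2)"
proof -
  have "\<forall>\<^sub>F l in sequentially. in_lp p K (\<lambda>k. \<psi>' l k - \<psi> k) \<and> lp_norm p K (\<lambda>k. \<psi>' l k - \<psi> k) < \<eta>"
    using assms(1,3) by (auto simp: seqs_converge_lp_def eventually_sequentially)
  then show ?thesis
  proof eventually_elim
    case (elim l)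
    show ?case
    proof (rule bessel_bound_if_L2_le[OF _ assms(3)])
      fix G assume G: "finite G" "G \<subseteq> K"
      have "L2_set (\<lambda>k. norm (\<psi>' l k - \<psi> k)) G \<le> lp_norm p K (\<lambda>k. \<psi>' l k - \<psi> k)"
        using assms(2)
      proof
        \<comment> \<open>On finite sets the l2 norm is at most the l1 norm, so both exponents give
          the same Bessel bound.\<close>
        assume "p = 1"
        then show ?thesis
          using elim G sum_norm_le_l1_norm[of K "\<lambda>k. \<psi>' l k - \<psi> k" G]
            L2_set_le_sum[of G "\<lambda>k. norm (\<psi>' l k - \<psi> k)"] by simp
      next
        assume "p = 2"
        then show ?thesis
          using elim G L2_set_le_l2_norm[of K "\<lambda>k. \<psi>' l k - \<psi> k" G] by simp
      qed
      then show "L2_set (\<lambda>k. norm (\<psi>' l k - \<psi> k)) G \<le> \<eta>" using elim by linarith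
    qed
  qed
qed

lemma seqs_converge_uniformlyD:
  assumes "seqs_converge_uniformly K \<psi>' \<psi>" "0 < \<eta>"
  shows "\<forall>\<^sub>F l in sequentially. \<forall>k\<in>K. norm (\<psi>' l k - \<psi> k) \<le> \<eta>"
proof -
  have "\<forall>\<^sub>F l in sequentially. in_linf K (\<lambda>k. \<psi>' l k - \<psi> k) \<and> linf_norm K (\<lambda>k. \<psi>' l k - \<psi> k) < \<eta>"
    using assms by (auto simp: seqs_converge_uniformly_def eventually_sequentially)
  then show ?thesis
    by eventually_elim (meson norm_le_linf_norm less_imp_le order_trans)
qed

section \<open>Simultaneous convergence in the three norms\<close>

lemma multiplier_converges_op:
  fixes \<psi> :: "'k \<Rightarrow> 'b::chilbert_space" and \<phi> :: "'k \<Rightarrow> 'a::chilbert_space"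
  assumes \<psi>: "bessel_bound K \<psi> B1" and \<phi>: "bessel_bound K \<phi> B2"
    and m: "symbols_converge_linf K m' m"
    and \<psi>': "seqs_converge_lp 1 K \<psi>' \<psi>" and \<phi>': "seqs_converge_lp 1 K \<phi>' \<phi>"
  shows "(\<forall>\<^sub>F l in sequentially. bessel K (\<psi>' l) \<and> bessel K (\<phi>' l)) \<and>
    converges_op (\<lambda>l. multiplier K (m' l) (\<psi>' l) (\<phi>' l)) (multiplier K m \<psi> \<phi>)"
proof -
  obtain s where s: "0 \<le> s" "\<forall>k\<in>K. cmod (m k) \<le> s"
    using symbols_converge_linfD(1)[OF m] by blast
  show ?thesis
  \<comment> \<open>\<open>0 \<le> s\<close> is stated because a pointwise bound over empty
    \<open>K\<close> does not imply it; \<open>0 < a\<close> is stated because the Bessel bound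
    \<open>a\<^sup>2\<close> forgets the sign of \<open>a\<close>.\<close>
  proof (rule multiplier_perturbation[where bnd = op_bound and s = s and a = "sqrt B1" and b = "sqrt B2"
        and symb = "\<lambda>c s. 0 \<le> s \<and> (\<forall>k\<in>K. cmod (c k) \<le> s)"
        and ?Q1.0 = "\<lambda>\<psi> a. 0 < a \<and> bessel_bound K \<psi> (a\<^sup>2)" and ?Q2.0 = "\<lambda>\<phi> a. 0 < a \<and> bessel_bound K \<phi> (a\<^sup>2)"])
    show "op_bound (multiplier K c \<psi> \<phi>) (s * a * b)"
      if "0 \<le> s \<and> (\<forall>k\<in>K. cmod (c k) \<le> s)" "0 < a \<and> bessel_bound K \<psi> (a\<^sup>2)" "0 < b \<and> bessel_bound K \<phi> (b\<^sup>2)"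
      for c s a b and \<psi> :: "'k \<Rightarrow> 'b" and \<phi> :: "'k \<Rightarrow> 'a"
      using that op_bound_multiplier[of K \<psi> "a\<^sup>2" \<phi> "b\<^sup>2" c s] by simp
    show "\<forall>\<^sub>F l in sequentially. 0 \<le> \<eta> \<and> (\<forall>k\<in>K. cmod (m' l k - m k) \<le> \<eta>)" if "0 < \<eta>" for \<eta>
      using symbols_converge_linfD(2)[OF m that] that by simp
    show "\<forall>\<^sub>F l in sequentially. 0 < \<eta> \<and> bessel_bound K (\<lambda>k. \<psi>' l k - \<psi> k) (\<eta>\<^sup>2)" if "0 < \<eta>" for \<eta>
      using seqs_converge_lpD[OF \<psi>' _ that] that by simp
    show "\<forall>\<^sub>F l in sequentially. 0 < \<eta> \<and> bessel_bound K (\<lambda>k. \<phi>' l k - \<phi> k) (\<eta>\<^sup>2)" if "0 < \<eta>" for \<eta>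
      using seqs_converge_lpD[OF \<phi>' _ that] that by simp
    show "converges_op S T" if "(h \<longlongrightarrow> 0) (at_right 0)"
      "\<And>\<eta>::real. 0 < \<eta> \<Longrightarrow> \<forall>\<^sub>F l in sequentially. op_bound (\<lambda>f. S l f - T f) (h \<eta>)"
      for h S and T :: "'a \<Rightarrow> 'b"
      using that by (rule converges_op_if_bounded)
    show "0 < sqrt B1 \<and> bessel_bound K \<psi> ((sqrt B1)\<^sup>2)" "0 < sqrt B2 \<and> bessel_bound K \<phi> ((sqrt B2)\<^sup>2)"
      using \<psi> \<phi> by (simp_all add: bessel_bound_def)
  qed (use s in \<open>auto simp: bessel_def intro: op_bound_add bessel_bound_add\<close>)
qed

lemma multiplier_converges_hs:
  fixes \<psi> :: "'k \<Rightarrow> 'b::chilbert_space" and \<phi> :: "'k \<Rightarrow> 'a::chilbert_space"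
  assumes \<psi>: "bessel_bound K \<psi> B1" and \<phi>: "bessel_bound K \<phi> B2"
    and m: "symbols_converge_lp 2 K m' m"
    and \<psi>': "seqs_converge_lp 2 K \<psi>' \<psi>" and \<phi>': "seqs_converge_lp 2 K \<phi>' \<phi>"
  shows "(\<forall>\<^sub>F l in sequentially. bessel K (\<psi>' l) \<and> bessel K (\<phi>' l)) \<and>
    converges_hs (\<lambda>l. multiplier K (m' l) (\<psi>' l) (\<phi>' l)) (multiplier K m \<psi> \<phi>)"
proof -
  obtain s where s: "\<forall>G. finite G \<longrightarrow> G \<subseteq> K \<longrightarrow> L2_set (\<lambda>k. cmod (m k)) G \<le> s"
    using symbols_converge_l2D(1)[OF m] by blast
  show ?thesis
  proof (rule multiplier_perturbation[where bnd = hs_bound and s = s and a = "sqrt B1" and b = "sqrt B2"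
        and symb = "\<lambda>c s. \<forall>G. finite G \<longrightarrow> G \<subseteq> K \<longrightarrow> L2_set (\<lambda>k. cmod (c k)) G \<le> s"
        and ?Q1.0 = "\<lambda>\<psi> a. 0 < a \<and> bessel_bound K \<psi> (a\<^sup>2)" and ?Q2.0 = "\<lambda>\<phi> a. 0 < a \<and> bessel_bound K \<phi> (a\<^sup>2)"])
    show "cmod (c k) \<le> s" if "\<forall>G. finite G \<longrightarrow> G \<subseteq> K \<longrightarrow> L2_set (\<lambda>k. cmod (c k)) G \<le> s" "k \<in> K" for c s k
      using that by (auto dest: spec[of _ "{k}"])
    show "hs_bound (multiplier K c \<psi> \<phi>) (s * a * b)"
      if "\<forall>G. finite G \<longrightarrow> G \<subseteq> K \<longrightarrow> L2_set (\<lambda>k. cmod (c k)) G \<le> s"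
        "0 < a \<and> bessel_bound K \<psi> (a\<^sup>2)" "0 < b \<and> bessel_bound K \<phi> (b\<^sup>2)"
      for c s a b and \<psi> :: "'k \<Rightarrow> 'b" and \<phi> :: "'k \<Rightarrow> 'a"
      using that hs_bound_multiplier[of K \<psi> "a\<^sup>2" \<phi> "b\<^sup>2" c s] by simp
    show "\<forall>\<^sub>F l in sequentially. \<forall>G. finite G \<longrightarrow> G \<subseteq> K \<longrightarrow> L2_set (\<lambda>k. cmod (m' l k - m k)) G \<le> \<eta>"
      if "0 < \<eta>" for \<eta>
      using symbols_converge_l2D(2)[OF m that] .
    show "\<forall>\<^sub>F l in sequentially. 0 < \<eta> \<and> bessel_bound K (\<lambda>k. \<psi>' l k - \<psi> k) (\<eta>\<^sup>2)" if "0 < \<eta>" for \<eta>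
      using seqs_converge_lpD[OF \<psi>' _ that] that by simp
    show "\<forall>\<^sub>F l in sequentially. 0 < \<eta> \<and> bessel_bound K (\<lambda>k. \<phi>' l k - \<phi> k) (\<eta>\<^sup>2)" if "0 < \<eta>" for \<eta>
      using seqs_converge_lpD[OF \<phi>' _ that] that by simp
    show "converges_hs S T" if "(h \<longlongrightarrow> 0) (at_right 0)"
      "\<And>\<eta>::real. 0 < \<eta> \<Longrightarrow> \<forall>\<^sub>F l in sequentially. hs_bound (\<lambda>f. S l f - T f) (h \<eta>)"
      for h S and T :: "'a \<Rightarrow> 'b"
      using that by (rule converges_hs_if_bounded)
    show "0 < sqrt B1 \<and> bessel_bound K \<psi> ((sqrt B1)\<^sup>2)" "0 < sqrt B2 \<and> bessel_bound K \<phi> ((sqrt B2)\<^sup>2)"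
      using \<psi> \<phi> by (simp_all add: bessel_bound_def)
  qed (use s in \<open>auto simp: bessel_def intro: hs_bound_add bessel_bound_add\<close>)
qed

lemma multiplier_converges_trace:
  fixes \<psi> :: "'k \<Rightarrow> 'b::chilbert_space" and \<phi> :: "'k \<Rightarrow> 'a::chilbert_space"
  assumes \<psi>: "bessel_bound K \<psi> B1" and \<phi>: "bessel_bound K \<phi> B2"
    and m: "symbols_converge_lp 1 K m' m"
    and bes: "\<And>l. bessel K (\<psi>' l)" "\<And>l. bessel K (\<phi>' l)"
    and \<psi>': "seqs_converge_uniformly K \<psi>' \<psi>" and \<phi>': "seqs_converge_uniformly K \<phi>' \<phi>"
  shows "converges_trace (\<lambda>l. multiplier K (m' l) (\<psi>' l) (\<phi>' l)) (multiplier K m \<psi> \<phi>)"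
proof -
  obtain s where s: "\<forall>G. finite G \<longrightarrow> G \<subseteq> K \<longrightarrow> (\<Sum>k\<in>G. cmod (m k)) \<le> s"
    using symbols_converge_l1D(1)[OF m] by blast
  have bes': "bessel K \<psi>" "bessel K \<phi>" using \<psi> \<phi> by (auto simp: bessel_def)
  have nonneg: "0 \<le> sqrt B1" "0 \<le> sqrt B2" using \<psi> \<phi> by (auto simp: bessel_bound_def)
  have "(\<forall>\<^sub>F l in sequentially. bessel K (\<psi>' l) \<and> bessel K (\<phi>' l)) \<and>
    converges_trace (\<lambda>l. multiplier K (m' l) (\<psi>' l) (\<phi>' l)) (multiplier K m \<psi> \<phi>)"
  \<comment> \<open>A supremum bound alone does not make a sequence Bessel, so the size predicates
    carry both properties; differences are Bessel because both sequences are.\<close>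
  proof (rule multiplier_perturbation[where bnd = nuclear_bound and s = s and a = "sqrt B1" and b = "sqrt B2"
        and symb = "\<lambda>c s. \<forall>G. finite G \<longrightarrow> G \<subseteq> K \<longrightarrow> (\<Sum>k\<in>G. cmod (c k)) \<le> s"
        and ?Q1.0 = "\<lambda>\<psi> a. bessel K \<psi> \<and> 0 \<le> a \<and> (\<forall>k\<in>K. norm (\<psi> k) \<le> a)"
        and ?Q2.0 = "\<lambda>\<phi> a. bessel K \<phi> \<and> 0 \<le> a \<and> (\<forall>k\<in>K. norm (\<phi> k) \<le> a)"])
    show "cmod (c k) \<le> s" if "\<forall>G. finite G \<longrightarrow> G \<subseteq> K \<longrightarrow> (\<Sum>k\<in>G. cmod (c k)) \<le> s" "k \<in> K" for c s k
      using that by (auto dest: spec[of _ "{k}"])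
    show "nuclear_bound (multiplier K c \<psi> \<phi>) (s * a * b)"
      if "\<forall>G. finite G \<longrightarrow> G \<subseteq> K \<longrightarrow> (\<Sum>k\<in>G. cmod (c k)) \<le> s"
        "bessel K \<psi> \<and> 0 \<le> a \<and> (\<forall>k\<in>K. norm (\<psi> k) \<le> a)" "bessel K \<phi> \<and> 0 \<le> b \<and> (\<forall>k\<in>K. norm (\<phi> k) \<le> b)"
      for c s a b and \<psi> :: "'k \<Rightarrow> 'b" and \<phi> :: "'k \<Rightarrow> 'a"
      using that nuclear_bound_multiplier[of K \<psi> \<phi> a b c s] by simp
    show "\<forall>\<^sub>F l in sequentially. \<forall>G. finite G \<longrightarrow> G \<subseteq> K \<longrightarrow> (\<Sum>k\<in>G. cmod (m' l k - m k)) \<le> \<eta>"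
      if "0 < \<eta>" for \<eta>
      using symbols_converge_l1D(2)[OF m that] .
    show "\<forall>\<^sub>F l in sequentially. bessel K (\<lambda>k. \<psi>' l k - \<psi> k) \<and> 0 \<le> \<eta> \<and> (\<forall>k\<in>K. norm (\<psi>' l k - \<psi> k) \<le> \<eta>)"
      if "0 < \<eta>" for \<eta>
      using seqs_converge_uniformlyD[OF \<psi>' that] that bessel_diff[OF bes(1) bes'(1)] by simp
    show "\<forall>\<^sub>F l in sequentially. bessel K (\<lambda>k. \<phi>' l k - \<phi> k) \<and> 0 \<le> \<eta> \<and> (\<forall>k\<in>K. norm (\<phi>' l k - \<phi> k) \<le> \<eta>)"
      if "0 < \<eta>" for \<eta>
      using seqs_converge_uniformlyD[OF \<phi>' that] that bessel_diff[OF bes(2) bes'(2)] by simp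
    show "converges_trace S T" if "(h \<longlongrightarrow> 0) (at_right 0)"
      "\<And>\<eta>::real. 0 < \<eta> \<Longrightarrow> \<forall>\<^sub>F l in sequentially. nuclear_bound (\<lambda>f. S l f - T f) (h \<eta>)"
      for h S and T :: "'a \<Rightarrow> 'b"
      using that by (rule converges_trace_if_bounded)
  qed (use s bes' nonneg in \<open>auto intro: norm_triangle_mono nuclear_bound_add bessel_add
      bessel_bound_norm_le[OF \<psi>] bessel_bound_norm_le[OF \<phi>]\<close>)
  then show ?thesis by blast
qed

section \<open>Constant sequences of symbols and vectors\<close>

lemma symbols_converge_linf_const: "symbols_converge_linf K (\<lambda>l. m) m \<longleftrightarrow> in_linf K m"
  by (auto simp: symbols_converge_linf_def linf_norm_def image_constant_conv)

lemma symbols_converge_lp_const: "symbols_converge_lp p K (\<lambda>l. m) m \<longleftrightarrow> in_lp p K m"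
  by (auto simp: symbols_converge_lp_def lp_norm_def)

lemma seqs_converge_lp_const: "seqs_converge_lp p K (\<lambda>l. \<psi>) \<psi>"
  by (auto simp: seqs_converge_lp_def in_lp_def lp_norm_def)

lemma seqs_converge_uniformly_const: "seqs_converge_uniformly K (\<lambda>l. \<psi>) \<psi>"
  by (auto simp: seqs_converge_uniformly_def in_linf_def linf_norm_def image_constant_conv)

theorem theorem8p1:
  fixes K :: "'k set"
    and \<psi> :: "'k \<Rightarrow> 'b::chilbert_space" and \<phi> :: "'k \<Rightarrow> 'a::chilbert_space"
    and \<psi>' :: "nat \<Rightarrow> 'k \<Rightarrow> 'b" and \<phi>' :: "nat \<Rightarrow> 'k \<Rightarrow> 'a"
    and m :: "'k \<Rightarrow> complex" and m' :: "nat \<Rightarrow> 'k \<Rightarrow> complex"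
    and B1 B2 :: real
  assumes "countable K"
    and "separable_space (euclidean :: 'a topology)"
    and "separable_space (euclidean :: 'b topology)"
    and "bessel_bound K \<psi> B1"
    and "bessel_bound K \<phi> B2"
  shows
    "((symbols_converge_linf K m' m \<longrightarrow>
         converges_op (\<lambda>l. multiplier K (m' l) \<psi> \<phi>) (multiplier K m \<psi> \<phi>)) \<and>
      (symbols_converge_lp 2 K m' m \<longrightarrow>
         converges_hs (\<lambda>l. multiplier K (m' l) \<psi> \<phi>) (multiplier K m \<psi> \<phi>)) \<and>
      (symbols_converge_lp 1 K m' m \<longrightarrow>
         converges_trace (\<lambda>l. multiplier K (m' l) \<psi> \<phi>) (multiplier K m \<psi> \<phi>))) \<and>
     ((in_lp 1 K m \<and> (\<forall>l. bessel K (\<psi>' l)) \<and> seqs_converge_uniformly K \<psi>' \<psi> \<longrightarrow>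
         converges_trace (\<lambda>l. multiplier K m (\<psi>' l) \<phi>) (multiplier K m \<psi> \<phi>)) \<and>
      (in_lp 2 K m \<and> seqs_converge_lp 2 K \<psi>' \<psi> \<longrightarrow>
         (\<forall>\<^sub>F l in sequentially. bessel K (\<psi>' l)) \<and>
         converges_hs (\<lambda>l. multiplier K m (\<psi>' l) \<phi>) (multiplier K m \<psi> \<phi>)) \<and>
      (in_linf K m \<and> seqs_converge_lp 1 K \<psi>' \<psi> \<longrightarrow>
         (\<forall>\<^sub>F l in sequentially. bessel K (\<psi>' l)) \<and>
         converges_op (\<lambda>l. multiplier K m (\<psi>' l) \<phi>) (multiplier K m \<psi> \<phi>))) \<and>
     ((\<forall>l. bessel K (\<phi>' l)) \<longrightarrow>
      (in_lp 1 K m \<and> seqs_converge_uniformly K \<phi>' \<phi> \<longrightarrow>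
         converges_trace (\<lambda>l. multiplier K m \<psi> (\<phi>' l)) (multiplier K m \<psi> \<phi>)) \<and>
      (in_lp 2 K m \<and> seqs_converge_lp 2 K \<phi>' \<phi> \<longrightarrow>
         converges_hs (\<lambda>l. multiplier K m \<psi> (\<phi>' l)) (multiplier K m \<psi> \<phi>)) \<and>
      (in_linf K m \<and> seqs_converge_lp 1 K \<phi>' \<phi> \<longrightarrow>
         converges_op (\<lambda>l. multiplier K m \<psi> (\<phi>' l)) (multiplier K m \<psi> \<phi>))) \<and>
     ((symbols_converge_lp 1 K m' m \<and>
       (\<exists>B1' B2' :: nat \<Rightarrow> real. \<exists>C1 C2 :: real. \<forall>l.
          bessel_bound K (\<psi>' l) (B1' l) \<and> bessel_bound K (\<phi>' l) (B2' l) \<and>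
          B1' l \<le> C1 \<and> B2' l \<le> C2) \<and>
       seqs_converge_uniformly K \<psi>' \<psi> \<and> seqs_converge_uniformly K \<phi>' \<phi> \<longrightarrow>
         converges_trace (\<lambda>l. multiplier K (m' l) (\<psi>' l) (\<phi>' l)) (multiplier K m \<psi> \<phi>)) \<and>
      (symbols_converge_lp 2 K m' m \<and>
       seqs_converge_lp 2 K \<psi>' \<psi> \<and> seqs_converge_lp 2 K \<phi>' \<phi> \<longrightarrow>
         (\<forall>\<^sub>F l in sequentially. bessel K (\<psi>' l) \<and> bessel K (\<phi>' l)) \<and>
         converges_hs (\<lambda>l. multiplier K (m' l) (\<psi>' l) (\<phi>' l)) (multiplier K m \<psi> \<phi>)) \<and>
      (symbols_converge_linf K m' m \<and>
       seqs_converge_lp 1 K \<psi>' \<psi> \<and> seqs_converge_lp 1 K \<phi>' \<phi> \<longrightarrow>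
         (\<forall>\<^sub>F l in sequentially. bessel K (\<psi>' l) \<and> bessel K (\<phi>' l)) \<and>
         converges_op (\<lambda>l. multiplier K (m' l) (\<psi>' l) (\<phi>' l)) (multiplier K m \<psi> \<phi>)))"
proof -
  note const = symbols_converge_linf_const symbols_converge_lp_const seqs_converge_lp_const
    seqs_converge_uniformly_const
  note op = multiplier_converges_op[OF assms(4,5)]
  note hs = multiplier_converges_hs[OF assms(4,5)]
  note tr = multiplier_converges_trace[OF assms(4,5)]
  have bes: "bessel K \<psi>" "bessel K \<phi>" using assms(4,5) by (auto simp: bessel_def)
  have "symbols_converge_linf K m' m \<longrightarrow>
      converges_op (\<lambda>l. multiplier K (m' l) \<psi> \<phi>) (multiplier K m \<psi> \<phi>)"
    using op[of m' m "\<lambda>l. \<psi>" "\<lambda>l. \<phi>"] by (simp add: const)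
  moreover have "symbols_converge_lp 2 K m' m \<longrightarrow>
      converges_hs (\<lambda>l. multiplier K (m' l) \<psi> \<phi>) (multiplier K m \<psi> \<phi>)"
    using hs[of m' m "\<lambda>l. \<psi>" "\<lambda>l. \<phi>"] by (simp add: const)
  moreover have "symbols_converge_lp 1 K m' m \<longrightarrow>
      converges_trace (\<lambda>l. multiplier K (m' l) \<psi> \<phi>) (multiplier K m \<psi> \<phi>)"
    using tr[of m' m "\<lambda>l. \<psi>" "\<lambda>l. \<phi>"] bes by (simp add: const)
  moreover have "in_lp 1 K m \<and> (\<forall>l. bessel K (\<psi>' l)) \<and> seqs_converge_uniformly K \<psi>' \<psi> \<longrightarrow>
      converges_trace (\<lambda>l. multiplier K m (\<psi>' l) \<phi>) (multiplier K m \<psi> \<phi>)"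
    using tr[of "\<lambda>l. m" m \<psi>' "\<lambda>l. \<phi>"] bes by (simp add: const)
  moreover have "in_lp 2 K m \<and> seqs_converge_lp 2 K \<psi>' \<psi> \<longrightarrow>
      (\<forall>\<^sub>F l in sequentially. bessel K (\<psi>' l)) \<and>
      converges_hs (\<lambda>l. multiplier K m (\<psi>' l) \<phi>) (multiplier K m \<psi> \<phi>)"
    using hs[of "\<lambda>l. m" m \<psi>' "\<lambda>l. \<phi>"] bes by (simp add: const)
  moreover have "in_linf K m \<and> seqs_converge_lp 1 K \<psi>' \<psi> \<longrightarrow>
      (\<forall>\<^sub>F l in sequentially. bessel K (\<psi>' l)) \<and>
      converges_op (\<lambda>l. multiplier K m (\<psi>' l) \<phi>) (multiplier K m \<psi> \<phi>)"
    using op[of "\<lambda>l. m" m \<psi>' "\<lambda>l. \<phi>"] bes by (simp add: const)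
  moreover have "(\<forall>l. bessel K (\<phi>' l)) \<longrightarrow> in_lp 1 K m \<and> seqs_converge_uniformly K \<phi>' \<phi> \<longrightarrow>
      converges_trace (\<lambda>l. multiplier K m \<psi> (\<phi>' l)) (multiplier K m \<psi> \<phi>)"
    using tr[of "\<lambda>l. m" m "\<lambda>l. \<psi>" \<phi>'] bes by (simp add: const)
  moreover have "in_lp 2 K m \<and> seqs_converge_lp 2 K \<phi>' \<phi> \<longrightarrow>
      converges_hs (\<lambda>l. multiplier K m \<psi> (\<phi>' l)) (multiplier K m \<psi> \<phi>)"
    using hs[of "\<lambda>l. m" m "\<lambda>l. \<psi>" \<phi>'] by (simp add: const)
  moreover have "in_linf K m \<and> seqs_converge_lp 1 K \<phi>' \<phi> \<longrightarrow>
      converges_op (\<lambda>l. multiplier K m \<psi> (\<phi>' l)) (multiplier K m \<psi> \<phi>)"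
    using op[of "\<lambda>l. m" m "\<lambda>l. \<psi>" \<phi>'] by (simp add: const)
  moreover have "symbols_converge_lp 1 K m' m \<and>
      (\<exists>B1' B2' :: nat \<Rightarrow> real. \<exists>C1 C2 :: real. \<forall>l.
         bessel_bound K (\<psi>' l) (B1' l) \<and> bessel_bound K (\<phi>' l) (B2' l) \<and> B1' l \<le> C1 \<and> B2' l \<le> C2) \<and>
      seqs_converge_uniformly K \<psi>' \<psi> \<and> seqs_converge_uniformly K \<phi>' \<phi> \<longrightarrow>
      converges_trace (\<lambda>l. multiplier K (m' l) (\<psi>' l) (\<phi>' l)) (multiplier K m \<psi> \<phi>)"
    using tr[of m' m \<psi>' \<phi>'] by (auto simp: bessel_def)
  ultimately show ?thesis
    using op[of m' m \<psi>' \<phi>'] hs[of m' m \<psi>' \<phi>'] by (intro conjI impI) simp_all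
qed

end
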